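(* Let $f:[0,1]\to\mathbb R$ be an arbitrary continuous and strictly concave function, and let $\Gamma_1,\Gamma_2,\Gamma_3,\ldots:I^2\to[0,1]$ be a sequence of graphons. If $W\in\mathbf{LIM}_{\mathrm{w}^*}(\Gamma_1,\Gamma_2,\Gamma_3,\ldots)$ is a cut-norm limit of versions of $\Gamma_1,\Gamma_2,\Gamma_3,\ldots$ (i.e., there are versions $\Gamma_n^*$ of $\Gamma_n$, $n\in\mathbb N$, with $\|\Gamma_n^*-W\|_\square\to0$), then $W$ is a minimizer of $\mathrm{INT}_f(\cdot)$ over $\mathbf{LIM}_{\mathrm{w}^*}(\Gamma_1,\Gamma_2,\Gamma_3,\ldots)$.
   Context: $I=[0,1]$ with Lebesgue measure. A graphon is a symmetric Lebesgue measurable function $I^2\to[0,1]$. A measurable $\gamma:I\to I$ is an almost-bijection if there are conull sets $J_1,J_2\subset I$ such that $\gamma|_{J_1}$ is a bijection of $J_1$ onto $J_2$; $\gamma^{-1}$ denotes $(\gamma|_{J_1})^{-1}$. A graphon $\Gamma'$ is a version of a graphon $\Gamma$ if there is a measure preserving almost-bijection $\gamma:I\to I$ with $\Gamma'(x,y)=\Gamma(\gamma^{-1}(x),\gamma^{-1}(y))$ for almost every $(x,y)\in I^2$. The weak$^*$ topology on graphons is that inherited from $L^\infty(I^2)=(L^1(I^2))^*$; equivalently, $W_n\to W$ weak$^*$ iff $\int_A\int_A W_n\to\int_A\int_A W$ for every measurable $A\subset I$. $\mathbf{LIM}_{\mathrm{w}^*}(\Gamma_1,\Gamma_2,\ldots)$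 is the set of all $W:I^2\to[0,1]$ for which there exist versions $\Gamma'_1,\Gamma'_2,\ldots$ of $\Gamma_1,\Gamma_2,\ldots$ such that $W$ is the weak$^*$ limit of the sequence $\Gamma'_1,\Gamma'_2,\ldots$ (such $W$ are graphons). The cut-norm is $\|U\|_\square=\sup_{A}\left|\int_A\int_A U(x,y)\right|$, the supremum over measurable $A\subset I$. For a graphon $W$, $\mathrm{INT}_f(W)=\int_{x\in I}\int_{y\in I}f(W(x,y))$. *)

theory Defs
  imports "HOL-Analysis.Analysis"
begin

definition strictly_concave_on :: "real set \<Rightarrow> (real \<Rightarrow> real) \<Rightarrow> bool" where
  "strictly_concave_on S f \<longleftrightarrow>
     convex S \<and>
     (\<forall>x\<in>S. \<forall>y\<in>S. \<forall>t. x \<noteq> y \<and> 0 < t \<and> t < 1 \<longrightarrow>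
        (1 - t) * f x + t * f y < f ((1 - t) * x + t * y))"

abbreviation unit_leb :: "real measure" where
  "unit_leb \<equiv> lebesgue_on {0..1}"

abbreviation unit_square_leb :: "(real \<times> real) measure" where
  "unit_square_leb \<equiv> lebesgue_on ({0..1} \<times> {0..1})"

(* Functions on the unit square are total functions on pairs of reals whose values
   outside the square are irrelevant. *)

definition unit_valued_kernel :: "(real \<times> real \<Rightarrow> real) \<Rightarrow> bool" where
  "unit_valued_kernel W \<longleftrightarrow>
     W \<in> borel_measurable unit_square_leb \<and> (\<forall>x\<in>{0..1}. \<forall>y\<in>{0..1}. W (x, y) \<in> {0..1})"

definition graphon :: "(real \<times> real \<Rightarrow> real) \<Rightarrow> bool" where
  "graphon W \<longleftrightarrow>
     unit_valued_kernel W \<and> (\<forall>x\<in>{0..1}. \<forall>y\<in>{0..1}. W (x, y) = W (y, x))"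

definition conull :: "real set \<Rightarrow> bool" where
  "conull J \<longleftrightarrow> J \<subseteq> {0..1} \<and> {0..1} - J \<in> null_sets unit_leb"

definition almost_bijection :: "(real \<Rightarrow> real) \<Rightarrow> real set \<Rightarrow> real set \<Rightarrow> bool" where
  "almost_bijection \<gamma> J\<^sub>1 J\<^sub>2 \<longleftrightarrow>
     \<gamma> \<in> measurable unit_leb unit_leb \<and> conull J\<^sub>1 \<and> conull J\<^sub>2 \<and> bij_betw \<gamma> J\<^sub>1 J\<^sub>2"

definition measure_preserving :: "(real \<Rightarrow> real) \<Rightarrow> bool" where
  "measure_preserving \<gamma> \<longleftrightarrow>
     \<gamma> \<in> measurable unit_leb unit_leb \<and> distr unit_leb unit_leb \<gamma> = unit_leb"

(* inv_into J\<^sub>1 \<gamma> is the inverse of the restriction of \<gamma> to J\<^sub>1; it is meaningful on J\<^sub>2 only,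
   which suffices because J\<^sub>2 is conull. *)
definition version_of :: "(real \<times> real \<Rightarrow> real) \<Rightarrow> (real \<times> real \<Rightarrow> real) \<Rightarrow> bool" where
  "version_of \<Gamma>' \<Gamma> \<longleftrightarrow>
     graphon \<Gamma>' \<and> graphon \<Gamma> \<and>
     (\<exists>\<gamma> J\<^sub>1 J\<^sub>2. almost_bijection \<gamma> J\<^sub>1 J\<^sub>2 \<and> measure_preserving \<gamma> \<and>
        (AE (x, y) in unit_square_leb. \<Gamma>' (x, y) = \<Gamma> (inv_into J\<^sub>1 \<gamma> x, inv_into J\<^sub>1 \<gamma> y)))"

(* Sequential convergence in the topology that L^infinity of the square carries as the dual of L^1. *)
definition weak_star_limit ::
    "(nat \<Rightarrow> real \<times> real \<Rightarrow> real) \<Rightarrow> (real \<times> real \<Rightarrow> real) \<Rightarrow> bool" where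
  "weak_star_limit V W \<longleftrightarrow>
     (\<forall>g. integrable unit_square_leb g \<longrightarrow>
        (\<lambda>n. LINT p|unit_square_leb. g p * V n p) \<longlonglongrightarrow> (LINT p|unit_square_leb. g p * W p))"

(* Weak* limits are determined up to null sets only, so the members of this set are
   symmetric almost everywhere, not necessarily everywhere. *)
definition LIM_weak_star ::
    "(nat \<Rightarrow> real \<times> real \<Rightarrow> real) \<Rightarrow> (real \<times> real \<Rightarrow> real) set" where
  "LIM_weak_star \<Gamma> =
     {W. unit_valued_kernel W \<and>
         (\<exists>\<Gamma>'. (\<forall>n. version_of (\<Gamma>' n) (\<Gamma> n)) \<and> weak_star_limit \<Gamma>' W)}"

definition cut_norm :: "(real \<times> real \<Rightarrow> real) \<Rightarrow> real" where
  "cut_norm U =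
     (SUP A \<in> sets unit_leb. \<bar>LINT x:A|lebesgue. (LINT y:A|lebesgue. U (x, y))\<bar>)"

definition INT_fun :: "(real \<Rightarrow> real) \<Rightarrow> (real \<times> real \<Rightarrow> real) \<Rightarrow> real" where
  "INT_fun f W = (LINT x|unit_leb. (LINT y|unit_leb. f (W (x, y))))"

end

theory Submission
  imports Defs
begin

text \<open>
  Let \<open>\<Gamma>'\<^sub>n\<close> be versions converging weak* to \<open>U\<close> and \<open>\<Gamma>\<^sup>*\<^sub>n\<close> versions converging to \<open>W\<close> in the
  cut norm. Rearranging \<open>W\<close> by the bijection that carries \<open>\<Gamma>\<^sup>*\<^sub>n\<close> to \<open>\<Gamma>'\<^sub>n\<close> gives kernels that are
  close to \<open>\<Gamma>'\<^sub>n\<close> in the cut norm, so they converge weak* to \<open>U\<close>, while the integral of \<open>f\<close> over each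
  of them equals that over \<open>W\<close>. The claim is then the weak* upper semicontinuity of \<open>INT\<^sub>f\<close> for concave
  \<open>f\<close>, which holds since \<open>f\<close> is, up to any \<open>\<epsilon>\<close>, a minimum of finitely many affine functions.

  The bijection is never inverted: if \<open>g\<close> and \<open>d\<close> are the measure preserving maps behind the two
  versions, then \<open>\<Gamma>'\<^sub>n \<circ> (g \<times> g) = \<Gamma>\<^sup>*\<^sub>n \<circ> (d \<times> d)\<close> almost everywhere, and both sides are compared after
  pulling them back. Since \<open>W\<close> is symmetric only up to null sets, it is replaced by its symmetrization,
  which by concavity can only increase the integral of \<open>f\<close>.
\<close>

section \<open>Completions and product measures\<close>

lemma sets_subset_if_measurable_ident:
  assumes "(\<lambda>x. x) \<in> measurable M N" and "space M = space N"
  shows "sets N \<subseteq> sets M"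
proof
  fix A assume "A \<in> sets N"
  then show "A \<in> sets M"
    using measurable_sets[OF assms(1), of A] sets.sets_into_space[of A N] assms(2)
    by (simp add: Int_absorb2)
qed

lemma AE_pair_measure_fst:
  assumes "sigma_finite_measure M2" and "AE x in M1. P x"
  shows "AE p in M1 \<Otimes>\<^sub>M M2. P (fst p)"
proof -
  interpret M2: sigma_finite_measure M2 by fact
  obtain N where N: "N \<in> null_sets M1" "{x \<in> space M1. \<not> P x} \<subseteq> N"
    using assms(2) unfolding eventually_ae_filter by auto
  have "N \<times> space M2 \<in> null_sets (M1 \<Otimes>\<^sub>M M2)"
    using N(1) by (auto simp: null_sets_def M2.emeasure_pair_measure_Times)
  then show ?thesis
    by (rule AE_I') (use N(2) in \<open>auto simp: space_pair_measure\<close>)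
qed

lemma AE_pair_measure_snd:
  assumes "sigma_finite_measure M2" and "AE y in M2. P y"
  shows "AE p in M1 \<Otimes>\<^sub>M M2. P (snd p)"
proof -
  interpret M2: sigma_finite_measure M2 by fact
  obtain N where N: "N \<in> null_sets M2" "{y \<in> space M2. \<not> P y} \<subseteq> N"
    using assms(2) unfolding eventually_ae_filter by auto
  have "space M1 \<times> N \<in> null_sets (M1 \<Otimes>\<^sub>M M2)"
    using N(1) by (auto simp: null_sets_def M2.emeasure_pair_measure_Times)
  then show ?thesis
    by (rule AE_I') (use N(2) in \<open>auto simp: space_pair_measure\<close>)
qed

text \<open>A measurable map stays measurable for the completions as soon as preimages of null sets
  are null. The second premise says this through almost-everywhere statements, the form in which
  projections satisfy it.\<close>

lemma measurable_completionI_AE: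
  assumes "g \<in> measurable M N"
    and "\<And>P. AE y in N. P y \<Longrightarrow> AE x in M. P (g x)"
  shows "g \<in> measurable (completion M) (completion N)"
proof (rule completion.measurable_completion2)
  show g: "g \<in> measurable (completion M) N"
    using assms(1) by (rule measurable_completion)
  show "null_sets N \<subseteq> null_sets (distr (completion M) N g)"
  proof
    fix X assume X: "X \<in> null_sets N"
    then have "AE y in N. y \<notin> X"
      by (rule AE_not_in)
    then have "AE x in completion M. g x \<notin> X"
      by (intro AE_completion assms(2))
    then have "emeasure (completion M) (g -` X \<inter> space M) = 0"
      using X measurable_sets[OF g, of X]
      by (subst (asm) AE_iff_measurable[where N="g -` X \<inter> space M"]) auto
    then show "X \<in> null_sets (distr (completion M) N g)"
      using X g by (auto simp: null_sets_def emeasure_distr)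
  qed
qed

lemma AE_main_part:
  assumes "A \<in> sets (completion M)"
  shows "AE x in M. x \<in> A \<longleftrightarrow> x \<in> main_part M A"
  using AE_notin_null_part[OF assms] main_part_null_part_Un[OF assms]
  by (auto elim!: eventually_mono)

lemma sigma_finite_measure_completion:
  assumes "sigma_finite_measure M"
  shows "sigma_finite_measure (completion M)"
proof -
  interpret sigma_finite_measure M by fact
  obtain F where "countable F" "F \<subseteq> sets M" "\<Union>F = space M" "\<forall>a\<in>F. emeasure M a \<noteq> \<infinity>"
    using sigma_finite_countable by blast
  then show ?thesis
    by (intro sigma_finite_measure.intro exI[of _ F]) (auto simp: subset_eq)
qed

text \<open>Null sets of a factor pull back to null sets of the product, so both projections are
  measurable for the completed sigma-algebras. The product of completions is thus coarser than the
  completed product, in general strictly, and the two have to be kept apart.\<close>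

lemma measurable_completion_pair:
  assumes "sigma_finite_measure M2"
  shows "(\<lambda>p. p) \<in> measurable (completion (M1 \<Otimes>\<^sub>M M2)) (completion M1 \<Otimes>\<^sub>M completion M2)"
proof -
  have "fst \<in> measurable (completion (M1 \<Otimes>\<^sub>M M2)) (completion M1)"
    by (intro measurable_completionI_AE AE_pair_measure_fst assms measurable_fst)
  moreover have "snd \<in> measurable (completion (M1 \<Otimes>\<^sub>M M2)) (completion M2)"
    by (intro measurable_completionI_AE AE_pair_measure_snd assms measurable_snd)
  ultimately show ?thesis
    by (auto intro: measurable_pair)
qed

lemma measurable_pair_completion:
  "(\<lambda>p. p) \<in> measurable (completion M1 \<Otimes>\<^sub>M completion M2) (M1 \<Otimes>\<^sub>M M2)"
  by (intro measurable_pair)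
    (auto simp: comp_def intro!: measurable_compose[OF measurable_fst] measurable_compose[OF measurable_snd]
      measurable_completion)

text \<open>A product measure is determined by its values on rectangles. On a rectangle each side
  can be exchanged, up to a null set, for its \<open>main_part\<close>, which is measurable before
  completion.\<close>

lemma distr_completion_pair:
  assumes "sigma_finite_measure M1" "sigma_finite_measure M2"
  shows "distr (completion (M1 \<Otimes>\<^sub>M M2)) (completion M1 \<Otimes>\<^sub>M completion M2) (\<lambda>p. p)
    = completion M1 \<Otimes>\<^sub>M completion M2"
proof (rule pair_measure_eqI[symmetric])
  interpret M1: sigma_finite_measure M1 by fact
  interpret M2: sigma_finite_measure M2 by fact
  show "sigma_finite_measure (completion M1)" "sigma_finite_measure (completion M2)"
    by (intro sigma_finite_measure_completion assms)+
  show "sets (completion M1 \<Otimes>\<^sub>M completion M2) =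
      sets (distr (completion (M1 \<Otimes>\<^sub>M M2)) (completion M1 \<Otimes>\<^sub>M completion M2) (\<lambda>p. p))"
    by simp
  fix A B assume A: "A \<in> sets (completion M1)" and B: "B \<in> sets (completion M2)"
  have AB: "A \<times> B \<in> sets (completion M1 \<Otimes>\<^sub>M completion M2)"
    using A B by auto
  have AB': "A \<times> B \<in> sets (completion (M1 \<Otimes>\<^sub>M M2))"
    using AB sets_subset_if_measurable_ident[OF measurable_completion_pair[OF assms(2)]]
    by (auto simp: space_pair_measure)
  have "AE p in M1 \<Otimes>\<^sub>M M2. fst p \<in> A \<longleftrightarrow> fst p \<in> main_part M1 A"
    by (rule AE_pair_measure_fst[OF assms(2) AE_main_part[OF A]])
  moreover have "AE p in M1 \<Otimes>\<^sub>M M2. snd p \<in> B \<longleftrightarrow> snd p \<in> main_part M2 B"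
    by (rule AE_pair_measure_snd[OF assms(2) AE_main_part[OF B]])
  ultimately have "AE p in completion (M1 \<Otimes>\<^sub>M M2). p \<in> A \<times> B \<longleftrightarrow> p \<in> main_part M1 A \<times> main_part M2 B"
    by (intro AE_completion) (rule eventually_elim2, auto simp: mem_Times_iff)
  then have "emeasure (completion (M1 \<Otimes>\<^sub>M M2)) (A \<times> B)
      = emeasure (completion (M1 \<Otimes>\<^sub>M M2)) (main_part M1 A \<times> main_part M2 B)"
    using A B AB' by (intro emeasure_eq_AE) auto
  also have "\<dots> = emeasure (completion M1) A * emeasure (completion M2) B"
    using A B by (simp add: M2.emeasure_pair_measure_Times)
  finally show "emeasure (completion M1) A * emeasure (completion M2) B
      = emeasure (distr (completion (M1 \<Otimes>\<^sub>M M2)) (completion M1 \<Otimes>\<^sub>M completion M2) (\<lambda>p. p)) (A \<times> B)"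
    using AB sets.sets_into_space[OF AB']
    by (simp add: emeasure_distr[OF measurable_completion_pair[OF assms(2)]] Int_absorb2)
qed

text \<open>The product of completions lies between the product and its completion, with the same
  measure, so almost-everywhere statements transfer both ways.\<close>

lemma AE_completion_pair_iff:
  assumes "sigma_finite_measure M1" "sigma_finite_measure M2"
  shows "(AE p in completion M1 \<Otimes>\<^sub>M completion M2. P p) \<longleftrightarrow> (AE p in M1 \<Otimes>\<^sub>M M2. P p)"
proof
  assume "AE p in completion M1 \<Otimes>\<^sub>M completion M2. P p"
  then have "AE p in completion (M1 \<Otimes>\<^sub>M M2). P p"
    using measurable_completion_pair[OF assms(2)]
    by (subst (asm) distr_completion_pair[OF assms, symmetric]) (drule AE_distrD[rotated], auto)
  then show "AE p in M1 \<Otimes>\<^sub>M M2. P p"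
    by (simp add: AE_completion_iff)
next
  assume "AE p in M1 \<Otimes>\<^sub>M M2. P p"
  then obtain N where N: "N \<in> null_sets (M1 \<Otimes>\<^sub>M M2)" "{p \<in> space (M1 \<Otimes>\<^sub>M M2). \<not> P p} \<subseteq> N"
    unfolding eventually_ae_filter by auto
  have N': "N \<in> sets (completion M1 \<Otimes>\<^sub>M completion M2)"
    using sets_subset_if_measurable_ident[OF measurable_pair_completion] N(1) by (auto simp: space_pair_measure)
  have "N \<in> null_sets (completion (M1 \<Otimes>\<^sub>M M2))"
    using N(1) by (rule null_sets_completionI)
  then have "N \<in> null_sets (distr (completion (M1 \<Otimes>\<^sub>M M2)) (completion M1 \<Otimes>\<^sub>M completion M2) (\<lambda>p. p))"
    using N' sets.sets_into_space[of N "completion (M1 \<Otimes>\<^sub>M M2)"]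
    by (simp add: null_sets_def emeasure_distr[OF measurable_completion_pair[OF assms(2)]] Int_absorb2)
  then have "N \<in> null_sets (completion M1 \<Otimes>\<^sub>M completion M2)"
    by (simp add: distr_completion_pair[OF assms])
  then show "AE p in completion M1 \<Otimes>\<^sub>M completion M2. P p"
    by (rule AE_I') (use N(2) in \<open>auto simp: space_pair_measure\<close>)
qed

text \<open>\<open>lebesgue_on\<close> restricts a completed measure, whereas the facts above speak
  of completions; this exchanges the two operations.\<close>

lemma completion_restrict_space:
  assumes "S \<in> sets M"
  shows "restrict_space (completion M) S = completion (restrict_space M S)"
proof (rule measure_eqI)
  have "A \<in> sets (completion (restrict_space M S)) \<longleftrightarrow> A \<in> sets (restrict_space (completion M) S)" for A
  proof
    assume "A \<in> sets (completion (restrict_space M S))"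
    then obtain X N N' where X: "A = X \<union> N" "N \<subseteq> N'" "N' \<in> null_sets (restrict_space M S)" "X \<in> sets (restrict_space M S)"
      by (rule sets_completionE)
    then have "A \<in> sets (completion M)" "A \<subseteq> S"
      using assms by (auto simp: null_sets_restrict_space sets_restrict_space_iff intro: sets_completionI)
    then show "A \<in> sets (restrict_space (completion M) S)"
      using assms by (auto simp: sets_restrict_space_iff)
  next
    assume "A \<in> sets (restrict_space (completion M) S)"
    then have A: "A \<in> sets (completion M)" "A \<subseteq> S"
      using assms by (auto simp: sets_restrict_space_iff)
    then obtain X N N' where X: "A = X \<union> N" "N \<subseteq> N'" "N' \<in> null_sets M" "X \<in> sets M"
      by (elim sets_completionE)
    show "A \<in> sets (completion (restrict_space M S))"
      using X A assms
      by (intro sets_completionI[of _ X N "N' \<inter> S"])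
         (auto simp: null_sets_restrict_space sets_restrict_space_iff null_set_Int2)
  qed
  then show eq: "sets (restrict_space (completion M) S) = sets (completion (restrict_space M S))"
    by auto
  fix A assume A0: "A \<in> sets (restrict_space (completion M) S)"
  then have A: "A \<in> sets (completion M)" "A \<subseteq> S" "A \<in> sets (completion (restrict_space M S))"
    using assms by (auto simp: sets_restrict_space_iff eq[symmetric])
  from A(3) have "AE x in restrict_space M S. x \<in> A \<longleftrightarrow> x \<in> main_part (restrict_space M S) A"
    by (rule AE_main_part)
  moreover have B: "main_part (restrict_space M S) A \<in> sets (restrict_space M S)"
    using A(3) by auto
  ultimately have "AE x in completion M. x \<in> A \<longleftrightarrow> x \<in> main_part (restrict_space M S) A"
    using assms A
    by (intro AE_completion) (auto simp: AE_restrict_space_iff sets_restrict_space_iff elim!: eventually_mono)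
  then have "emeasure (completion M) A = emeasure (completion M) (main_part (restrict_space M S) A)"
    using A B assms by (intro emeasure_eq_AE) (auto simp: sets_restrict_space_iff)
  then show "emeasure (restrict_space (completion M) S) A = emeasure (completion (restrict_space M S)) A"
    using A B assms by (simp add: emeasure_restrict_space sets_restrict_space_iff)
qed

text \<open>The sigma-algebras coincide because the identity is measurable both ways, the measures
  because they agree on rectangles.\<close>

lemma restrict_space_pair_measure:
  assumes "sigma_finite_measure M1" "sigma_finite_measure M2" "A \<in> sets M1" "B \<in> sets M2"
  shows "restrict_space (M1 \<Otimes>\<^sub>M M2) (A \<times> B) = restrict_space M1 A \<Otimes>\<^sub>M restrict_space M2 B"
proof (rule pair_measure_eqI[symmetric])
  interpret M1: sigma_finite_measure M1 by fact
  interpret M2: sigma_finite_measure M2 by fact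
  show "sigma_finite_measure (restrict_space M1 A)" "sigma_finite_measure (restrict_space M2 B)"
    using assms by (auto intro: sigma_finite_measure_restrict_space)
  have AB: "A \<times> B \<in> sets (M1 \<Otimes>\<^sub>M M2)"
    using assms by auto
  have sub: "A \<subseteq> space M1" "B \<subseteq> space M2"
    using assms by (auto dest: sets.sets_into_space)
  have "fst \<in> measurable (restrict_space (M1 \<Otimes>\<^sub>M M2) (A \<times> B)) (restrict_space M1 A)"
    by (intro measurable_restrict_space2 measurable_restrict_space1 measurable_fst) (auto simp: space_restrict_space)
  moreover have "snd \<in> measurable (restrict_space (M1 \<Otimes>\<^sub>M M2) (A \<times> B)) (restrict_space M2 B)"
    by (intro measurable_restrict_space2 measurable_restrict_space1 measurable_snd) (auto simp: space_restrict_space)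
  ultimately have 1: "(\<lambda>p. p) \<in> measurable (restrict_space (M1 \<Otimes>\<^sub>M M2) (A \<times> B))
      (restrict_space M1 A \<Otimes>\<^sub>M restrict_space M2 B)"
    by (intro measurable_pair) (auto simp: comp_def)
  have id: "(\<lambda>x. x) \<in> measurable (restrict_space M1 A) M1" "(\<lambda>x. x) \<in> measurable (restrict_space M2 B) M2"
    by (auto intro: measurable_restrict_space1)
  have "(\<lambda>p. p) \<in> measurable (restrict_space M1 A \<Otimes>\<^sub>M restrict_space M2 B) (M1 \<Otimes>\<^sub>M M2)"
    using measurable_compose[OF measurable_fst id(1)] measurable_compose[OF measurable_snd id(2)]
    by (intro measurable_pair) (auto simp: comp_def)
  then have 2: "(\<lambda>p. p) \<in> measurable (restrict_space M1 A \<Otimes>\<^sub>M restrict_space M2 B)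
      (restrict_space (M1 \<Otimes>\<^sub>M M2) (A \<times> B))"
    by (intro measurable_restrict_space2) (auto simp: space_pair_measure space_restrict_space)
  have space: "space (restrict_space (M1 \<Otimes>\<^sub>M M2) (A \<times> B)) = space (restrict_space M1 A \<Otimes>\<^sub>M restrict_space M2 B)"
    using sub by (auto simp: space_pair_measure space_restrict_space)
  show "sets (restrict_space M1 A \<Otimes>\<^sub>M restrict_space M2 B) = sets (restrict_space (M1 \<Otimes>\<^sub>M M2) (A \<times> B))"
    by (intro equalityI sets_subset_if_measurable_ident 1 2 space space[symmetric])
  fix X Y assume "X \<in> sets (restrict_space M1 A)" "Y \<in> sets (restrict_space M2 B)"
  then show "emeasure (restrict_space M1 A) X * emeasure (restrict_space M2 B) Y
      = emeasure (restrict_space (M1 \<Otimes>\<^sub>M M2) (A \<times> B)) (X \<times> Y)"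
    using assms AB
    by (subst (3) emeasure_restrict_space)
       (auto simp: emeasure_restrict_space sets_restrict_space_iff M2.emeasure_pair_measure_Times sets.Int_space_eq2)
qed

text \<open>In a complete measure space, changing a function on a null set keeps it measurable. This
  covers inner integrals of kernels that are product measurable only up to null sets.\<close>

lemma borel_measurable_completion_cong_AE:
  fixes g h :: "'a \<Rightarrow> real"
  assumes "h \<in> borel_measurable (completion M)" and "AE x in completion M. g x = h x"
  shows "g \<in> borel_measurable (completion M)"
proof (rule measurableI)
  fix X :: "real set" assume "X \<in> sets borel"
  then have "h -` X \<inter> space M \<in> sets (completion M)"
    using measurable_sets[OF assms(1)] by auto
  moreover have "AE x in completion M. x \<in> h -` X \<inter> space M \<longleftrightarrow> x \<in> g -` X \<inter> space M"
    using assms(2) by (auto elim!: eventually_mono)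
  ultimately have "g -` X \<inter> space M \<in> sets (completion M)"
    using completion.in_sets_AE[of "h -` X \<inter> space M" "g -` X \<inter> space M" M] by simp
  then show "g -` X \<inter> space (completion M) \<in> sets (completion M)"
    by simp
qed auto

lemma integral_completion_cong_AE:
  fixes g h :: "'a \<Rightarrow> real"
  assumes "h \<in> borel_measurable (completion M)" and "AE x in completion M. g x = h x"
  shows "(LINT x|completion M. g x) = (LINT x|completion M. h x)"
  using borel_measurable_completion_cong_AE[OF assms] assms by (intro integral_cong_AE)

section \<open>Weak upper semicontinuity of concave integrals\<close>

lemma closed_epigraph_continuous:
  fixes f :: "'a::t2_space \<Rightarrow> real"
  assumes "closed S" "continuous_on S f"
  shows "closed (epigraph S f)"
proof -
  have "continuous_on (S \<times> UNIV) (\<lambda>p. snd p - f (fst p))"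
    by (intro continuous_intros continuous_on_compose2[OF assms(2)]) auto
  then have "closed ((S \<times> UNIV) \<inter> (\<lambda>p. snd p - f (fst p)) -` {0..})"
    by (intro continuous_closed_preimage closed_Times assms(1)) auto
  moreover have "epigraph S f = (S \<times> UNIV) \<inter> (\<lambda>p. snd p - f (fst p)) -` {0..}"
    by (auto simp: epigraph_def)
  ultimately show ?thesis
    by simp
qed

text \<open>
  Separating a point strictly above the graph from the hypograph, instead of taking a tangent, avoids
  infinite slopes at the boundary of \<open>S\<close>.
\<close>

lemma concave_on_affine_majorant:
  fixes f :: "real \<Rightarrow> real"
  assumes "closed S" "concave_on S f" "continuous_on S f" "u \<in> S" "0 < e"
  obtains a b where "\<And>w. w \<in> S \<Longrightarrow> f w \<le> a + b * w" "a + b * u < f u + e"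
proof -
  let ?E = "epigraph S (\<lambda>x. - f x)"
  have "closed ?E"
    using assms by (intro closed_epigraph_continuous continuous_intros)
  moreover have "convex ?E"
    using assms(2) concave_on_imp_convex[OF assms(2)] by (simp add: concave_on_def convex_epigraph)
  moreover have "(u, - f u - e) \<notin> ?E"
    using assms by (simp add: mem_epigraph)
  ultimately have "\<exists>a b. inner a (u, - f u - e) < b \<and> (\<forall>x\<in>?E. inner a x > b)"
    by (intro separating_hyperplane_closed_point)
  then obtain a b where ab: "inner a (u, - f u - e) < b" "\<And>x. x \<in> ?E \<Longrightarrow> inner a x > b"
    by blast
  obtain c d where a: "a = (c, d)"
    by (cases a)
  \<comment> \<open>The point \<open>(u, - f u)\<close> of the epigraph lies directly above the
    separated point, so comparing the two gives \<open>0 < d\<close>: the hyperplane is not vertical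
    and is the graph of an affine function.\<close>
  have "b < c * u + d * (- f u)"
    using ab(2)[of "(u, - f u)"] assms(4) by (simp add: a mem_epigraph)
  moreover have less: "c * u + d * (- f u - e) < b"
    using ab(1) by (simp add: a)
  ultimately have "0 < d * e"
    by (simp add: algebra_simps)
  then have d: "0 < d"
    using assms(5) by (simp add: zero_less_mult_iff)
  show ?thesis
  proof (rule that[of "- b / d" "c / d"])
    fix w assume "w \<in> S"
    then have "b < c * w + d * (- f w)"
      using ab(2)[of "(w, - f w)"] by (simp add: a mem_epigraph)
    then show "f w \<le> - b / d + c / d * w"
      using d by (simp add: field_simps)
  next
    show "- b / d + c / d * u < f u + e"
      using d less by (simp add: field_simps)
  qed
qed

text \<open>Near each point of \<open>S\<close> one affine majorant stays within \<open>e\<close> of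
  \<open>f\<close> by continuity; compactness leaves finitely many of them. Up to the error
  \<open>e\<close>, their minimum is \<open>f\<close>.\<close>

lemma concave_on_finite_affine_majorants:
  fixes f :: "real \<Rightarrow> real"
  assumes "compact S" "concave_on S f" "continuous_on S f" "0 < e"
  shows "\<exists>(k::nat) a b. (\<forall>i<k. \<forall>w\<in>S. f w \<le> a i + b i * w) \<and> (\<forall>u\<in>S. \<exists>i<k. a i + b i * u < f u + e)"
proof -
  have "\<exists>a b T. (\<forall>w\<in>S. f w \<le> a + b * w) \<and> open T \<and> u \<in> T \<and> (\<forall>w\<in>S \<inter> T. a + b * w < f w + e)"
    if u: "u \<in> S" for u
  proof -
    obtain a b where ab: "\<And>w. w \<in> S \<Longrightarrow> f w \<le> a + b * w" "a + b * u < f u + e"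
      using concave_on_affine_majorant[OF compact_imp_closed[OF assms(1)] assms(2,3) u assms(4)] by metis
    have "continuous_on S (\<lambda>w. f w + e - (a + b * w))"
      by (intro continuous_intros assms(3))
    then have "((\<lambda>w. f w + e - (a + b * w)) \<longlongrightarrow> f u + e - (a + b * u)) (at u within S)"
      using u by (simp add: continuous_on_def)
    then have "\<forall>\<^sub>F w in at u within S. 0 < f w + e - (a + b * w)"
      using ab(2) by (intro order_tendstoD) auto
    then obtain T where "open T" "u \<in> T" "\<And>w. w \<in> T \<Longrightarrow> w \<in> S \<Longrightarrow> a + b * w < f w + e"
      using ab(2) unfolding eventually_at_topological by (smt (verit))
    then show ?thesis
      using ab(1) by (intro exI[of _ a] exI[of _ b] exI[of _ T]) auto
  qed
  then obtain a b T where abT: "\<And>u w. u \<in> S \<Longrightarrow> w \<in> S \<Longrightarrow> f w \<le> a u + b u * w"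
    "\<And>u. u \<in> S \<Longrightarrow> open (T u)" "\<And>u. u \<in> S \<Longrightarrow> u \<in> T u"
    "\<And>u w. u \<in> S \<Longrightarrow> w \<in> S \<Longrightarrow> w \<in> T u \<Longrightarrow> a u + b u * w < f w + e"
    by (metis IntI)
  have "S \<subseteq> (\<Union>c\<in>S. T c)"
    using abT(3) by auto
  then obtain C where C: "C \<subseteq> S" "finite C" "S \<subseteq> (\<Union>c\<in>C. T c)"
    by (metis compactE_image[OF assms(1), of S T] abT(2))
  \<comment> \<open>Numbering the finite cover allows a least suitable index to be selected
    later.\<close>
  obtain h where h: "bij_betw h {0..<card C} C"
    using ex_bij_betw_nat_finite[OF C(2)] by blast
  show ?thesis
  proof (rule exI[of _ "card C"], rule exI[of _ "a \<circ> h"], rule exI[of _ "b \<circ> h"], intro conjI allI impI ballI)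
    show "f w \<le> (a \<circ> h) i + (b \<circ> h) i * w" if "i < card C" "w \<in> S" for i w
      using abT(1)[of "h i" w] that bij_betw_apply[OF h, of i] C(1) by auto
    show "\<exists>i<card C. (a \<circ> h) i + (b \<circ> h) i * u < f u + e" if u: "u \<in> S" for u
    proof -
      obtain c where c: "c \<in> C" "u \<in> T c"
        using C(3) u by blast
      from c(1) have "c \<in> h ` {0..<card C}"
        by (simp add: bij_betw_imp_surj_on[OF h])
      then obtain i where i: "i < card C" "c = h i"
        by auto
      have "a c + b c * u < f u + e"
        using c C(1) u by (intro abT(4)) auto
      then have "i < card C \<and> (a \<circ> h) i + (b \<circ> h) i * u < f u + e"
        using i by simp
      then show ?thesis
        by (rule exI)
    qed
  qed
qed

section \<open>Integrals of concave functions along weak limits\<close>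

lemma borel_measurable_continuous_compose:
  fixes f :: "'b::topological_space \<Rightarrow> 'c::topological_space"
  assumes "continuous_on S f" "W \<in> borel_measurable N" "\<And>p. p \<in> space N \<Longrightarrow> W p \<in> S"
  shows "(\<lambda>p. f (W p)) \<in> borel_measurable N"
proof -
  have "W \<in> measurable N (restrict_space borel S)"
    using assms(2,3) by (intro measurable_restrict_space2) auto
  from measurable_compose[OF this borel_measurable_continuous_on_restrict[OF assms(1)]]
  show ?thesis .
qed

lemma (in finite_measure) integrable_continuous_compose:
  fixes f :: "real \<Rightarrow> real"
  assumes "compact S" "continuous_on S f" "W \<in> borel_measurable M" "\<And>p. p \<in> space M \<Longrightarrow> W p \<in> S"
  shows "integrable M (\<lambda>p. f (W p))"
proof -
  have "bounded (f ` S)"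
    using assms by (intro compact_imp_bounded compact_continuous_image)
  then obtain B where "\<And>x. x \<in> S \<Longrightarrow> norm (f x) \<le> B"
    by (auto simp: bounded_iff)
  then show ?thesis
    using assms(4) borel_measurable_continuous_compose[OF assms(2-4)]
    by (intro integrable_const_bound[of _ B]) auto
qed

text \<open>Affine functionals pass to weak limits. So the space is cut into finitely many pieces,
  on each of which one affine majorant of \<open>f\<close> is within \<open>e\<close> of
  \<open>f (U p)\<close>. The hypothesis \<open>lim\<close> describes \<open>W\<close> rearranged by
  \<open>d n\<close> after the inverse of \<open>g n\<close>, written so that no inverse
  appears.\<close>

lemma (in finite_measure) integral_concave_le_weak_limit:
  fixes f :: "real \<Rightarrow> real"
  assumes S: "compact S" and f: "concave_on S f" "continuous_on S f"
    and U: "U \<in> borel_measurable M" "\<And>p. p \<in> space M \<Longrightarrow> U p \<in> S"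
    and W: "W \<in> borel_measurable M" "\<And>p. p \<in> space M \<Longrightarrow> W p \<in> S"
    and g: "\<And>n::nat. g n \<in> measurable M M" "\<And>n. distr M M (g n) = M"
    and d: "\<And>n. d n \<in> measurable M M" "\<And>n. distr M M (d n) = M"
    and lim: "\<And>A. A \<in> sets M \<Longrightarrow>
      (\<lambda>n. LINT p|M. indicator A (g n p) * W (d n p)) \<longlonglongrightarrow> (LINT p|M. indicator A p * U p)"
  shows "(LINT p|M. f (W p)) \<le> (LINT p|M. f (U p))"
proof -
  have "(LINT p|M. f (W p)) \<le> (LINT p|M. f (U p)) + e * measure M (space M)" if e: "0 < e" for e
  proof -
    obtain k :: nat and a b :: "nat \<Rightarrow> real"
      where "\<forall>i<k. \<forall>w\<in>S. f w \<le> a i + b i * w" "\<forall>u\<in>S. \<exists>i<k. a i + b i * u < f u + e"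
      using concave_on_finite_affine_majorants[OF S f e] by blast
    then have ab: "\<And>i w. i < k \<Longrightarrow> w \<in> S \<Longrightarrow> f w \<le> a i + b i * w"
      and ex: "\<And>u. u \<in> S \<Longrightarrow> \<exists>i<k. a i + b i * u < f u + e"
      by blast+
    define P where "P i p \<longleftrightarrow> a i + b i * U p < f (U p) + e" for i :: nat and p
    \<comment> \<open>Taking the least index makes the pieces \<open>A i\<close> disjoint, and keeps
      them measurable.\<close>
    define \<kappa> where "\<kappa> p = (LEAST i. P i p)" for p
    define A where "A i = {p \<in> space M. \<kappa> p = i}" for i
    note fU [measurable] = borel_measurable_continuous_compose[OF f(2) U]
    note [measurable] = U(1) W(1) g(1) d(1)
    have [measurable]: "Measurable.pred M (P i)" for i
      unfolding P_def by measurable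
    have [measurable]: "A i \<in> sets M" for i
      unfolding A_def \<kappa>_def by measurable
    have \<kappa>: "\<kappa> p < k" "a (\<kappa> p) + b (\<kappa> p) * U p < f (U p) + e" if p: "p \<in> space M" for p
    proof -
      obtain i where "i < k" "P i p"
        using ex[OF U(2)[OF p]] by (auto simp: P_def)
      then show "\<kappa> p < k"
        using Least_le[of "\<lambda>i. P i p" i] by (simp add: \<kappa>_def)
      have "P (\<kappa> p) p"
        unfolding \<kappa>_def using \<open>P i p\<close> by (rule LeastI)
      then show "a (\<kappa> p) + b (\<kappa> p) * U p < f (U p) + e"
        by (simp add: P_def)
    qed
    \<comment> \<open>Exactly one piece with index below \<open>k\<close> contains \<open>p\<close>,
      so the sum collapses to the affine function selected there.\<close>
    have A_sum: "(\<Sum>i<k. a i * indicator (A i) p + b i * (indicator (A i) p * w)) = a (\<kappa> p) + b (\<kappa> p) * w"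
      if "p \<in> space M" for p w
    proof -
      have "(\<Sum>i<k. a i * indicator (A i) p + b i * (indicator (A i) p * w))
          = (\<Sum>i<k. if \<kappa> p = i then a i + b i * w else 0)"
        using that by (intro sum.cong) (auto simp: A_def)
      then show ?thesis
        using \<kappa>(1)[OF that] by simp
    qed
    have "bounded S"
      using S by (rule compact_imp_bounded)
    then obtain B where B: "\<And>x. x \<in> S \<Longrightarrow> \<bar>x\<bar> \<le> B"
      by (auto simp: bounded_iff)
    have B0: "0 \<le> B" if "p \<in> space M" for p
      using B[OF U(2)[OF that]] by linarith
    have d_in: "d n p \<in> space M" "g n p \<in> space M" if "p \<in> space M" for n p
      using that measurable_space[OF d(1)] measurable_space[OF g(1)] by auto
    have int1: "integrable M (\<lambda>p. indicator (A i) (g n p) * W (d n p))" for i n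
      using B W(2) B0 d_in by (intro integrable_const_bound[of _ B]) (auto simp: indicator_def)
    have int2: "integrable M (\<lambda>p. indicator (A i) p * U p)" for i
      using B U(2) B0 by (intro integrable_const_bound[of _ B]) (auto simp: indicator_def)
    have int3: "integrable M (\<lambda>p. indicator (A i) (g n p) :: real)" for i n
      by (intro integrable_const_bound[of _ 1]) (auto simp: indicator_def)
    have int4: "integrable M (indicator (A i) :: 'a \<Rightarrow> real)" for i
      by (intro integrable_const_bound[of _ 1]) (auto simp: indicator_def)
    have meas: "(LINT p|M. indicator (A i) (g n p)) = measure M (A i)" for i n
    proof -
      have "(LINT p|M. indicator (A i) (g n p)) = (LINT p|distr M M (g n). indicator (A i) p :: real)"
        by (rule integral_distr[symmetric]) auto
      then show ?thesis
        by (simp add: g(2))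
    qed
    \<comment> \<open>The left side is the same for every \<open>n\<close>, since \<open>d n\<close>
      preserves the measure. The bound uses the majorant selected at \<open>g n p\<close>, evaluated
      at \<open>W (d n p)\<close>.\<close>
    have upper: "(LINT p|M. f (W p)) \<le> (\<Sum>i<k. a i * measure M (A i)
        + b i * (LINT p|M. indicator (A i) (g n p) * W (d n p)))" for n
    proof -
      have "(LINT p|M. f (W p)) = (LINT p|distr M M (d n). f (W p))"
        by (simp add: d(2))
      also have "\<dots> = (LINT p|M. f (W (d n p)))"
        by (intro integral_distr d(1) borel_measurable_continuous_compose[OF f(2) W])
      also have "\<dots> \<le> (LINT p|M. (\<Sum>i<k. a i * indicator (A i) (g n p) + b i * (indicator (A i) (g n p) * W (d n p))))"
      proof (rule integral_mono)
        show "integrable M (\<lambda>p. f (W (d n p)))"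
          using d_in W by (intro integrable_continuous_compose[OF S f(2)]) auto
        show "integrable M (\<lambda>p. \<Sum>i<k. a i * indicator (A i) (g n p) + b i * (indicator (A i) (g n p) * W (d n p)))"
          using int1 int3
          by (intro Bochner_Integration.integrable_sum Bochner_Integration.integrable_add integrable_mult_right) auto
        show "f (W (d n p)) \<le> (\<Sum>i<k. a i * indicator (A i) (g n p) + b i * (indicator (A i) (g n p) * W (d n p)))" if "p \<in> space M" for p
          using that d_in[OF that] ab[OF \<kappa>(1)] W(2) by (simp add: A_sum)
      qed
      also have "\<dots> = (\<Sum>i<k. a i * measure M (A i) + b i * (LINT p|M. indicator (A i) (g n p) * W (d n p)))"
        using int1 int3 by (simp add: meas)
      finally show ?thesis .
    qed
    have "(LINT p|M. f (W p)) \<le> (\<Sum>i<k. a i * measure M (A i) + b i * (LINT p|M. indicator (A i) p * U p))"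
    proof (rule LIMSEQ_le_const)
      show "(\<lambda>n. \<Sum>i<k. a i * measure M (A i) + b i * (LINT p|M. indicator (A i) (g n p) * W (d n p)))
          \<longlonglongrightarrow> (\<Sum>i<k. a i * measure M (A i) + b i * (LINT p|M. indicator (A i) p * U p))"
        by (intro tendsto_sum tendsto_add tendsto_mult tendsto_const lim) auto
    qed (use upper in auto)
    also have "\<dots> = (LINT p|M. (\<Sum>i<k. a i * indicator (A i) p + b i * (indicator (A i) p * U p)))"
      using int2 int4 by simp
    also have "\<dots> \<le> (LINT p|M. f (U p) + e)"
    proof (rule integral_mono)
      show "integrable M (\<lambda>p. \<Sum>i<k. a i * indicator (A i) p + b i * (indicator (A i) p * U p))"
        by (intro Bochner_Integration.integrable_sum Bochner_Integration.integrable_add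
            integrable_mult_right int2 int4)
      show "integrable M (\<lambda>p. f (U p) + e)"
        using integrable_continuous_compose[OF S f(2) U] by simp
      show "(\<Sum>i<k. a i * indicator (A i) p + b i * (indicator (A i) p * U p)) \<le> f (U p) + e" if "p \<in> space M" for p
        using \<kappa>(2)[OF that] that by (simp add: A_sum)
    qed
    also have "\<dots> = (LINT p|M. f (U p)) + e * measure M (space M)"
      using integrable_continuous_compose[OF S f(2) U] by simp
    finally show ?thesis .
  qed
  note * = this
  show ?thesis
  proof (rule field_le_epsilon)
    fix e :: real assume e: "0 < e"
    \<comment> \<open>The summand 1 keeps the divisor positive when the space has measure
      zero.\<close>
    have "e / (1 + measure M (space M)) * measure M (space M) \<le> e"
      using e add_pos_nonneg[OF zero_less_one measure_nonneg[of M "space M"]] by (simp add: field_simps)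
    then show "(LINT p|M. f (W p)) \<le> (LINT p|M. f (U p)) + e"
      using *[of "e / (1 + measure M (space M))"] e by (simp add: add_pos_nonneg)
  qed
qed

section \<open>Measure preserving maps and rectangles\<close>

lemma integral_compose_measure_preserving:
  fixes h :: "'a \<Rightarrow> real"
  assumes "d \<in> measurable M M" "distr M M d = M" "h \<in> borel_measurable M"
  shows "(LINT x|M. h (d x)) = (LINT x|M. h x)"
  using integral_distr[OF assms(1,3)] assms(2) by simp

lemma integrable_compose_measure_preserving:
  fixes h :: "'a \<Rightarrow> real"
  assumes "d \<in> measurable M M" "distr M M d = M" "integrable M h"
  shows "integrable M (\<lambda>x. h (d x))"
  using integrable_distr[OF assms(1), of h] assms(2,3) by simp

lemma measure_preserving_pair:
  assumes "sigma_finite_measure M" and d: "d \<in> measurable M M" "distr M M d = M"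
  shows "(\<lambda>p. (d (fst p), d (snd p))) \<in> measurable (M \<Otimes>\<^sub>M M) (M \<Otimes>\<^sub>M M)"
    and "distr (M \<Otimes>\<^sub>M M) (M \<Otimes>\<^sub>M M) (\<lambda>p. (d (fst p), d (snd p))) = M \<Otimes>\<^sub>M M"
proof -
  note [measurable] = d(1)
  show "(\<lambda>p. (d (fst p), d (snd p))) \<in> measurable (M \<Otimes>\<^sub>M M) (M \<Otimes>\<^sub>M M)"
    by measurable
  show "distr (M \<Otimes>\<^sub>M M) (M \<Otimes>\<^sub>M M) (\<lambda>p. (d (fst p), d (snd p))) = M \<Otimes>\<^sub>M M"
    using pair_measure_distr[OF d(1) d(1)] assms by (simp add: case_prod_unfold)
qed

lemma AE_compose_measure_preserving:
  assumes "d \<in> measurable M M" "distr M M d = M" "AE x in M. P x"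
  shows "AE x in M. P (d x)"
  by (rule AE_distrD[OF assms(1)]) (subst assms(2), rule assms(3))

lemma (in finite_measure) measure_preserving_swap:
  "prod.swap \<in> measurable (M \<Otimes>\<^sub>M M) (M \<Otimes>\<^sub>M M)"
  "distr (M \<Otimes>\<^sub>M M) (M \<Otimes>\<^sub>M M) prod.swap = M \<Otimes>\<^sub>M M"
proof -
  interpret pair_sigma_finite M M ..
  have eq: "prod.swap = (\<lambda>(x, y). (y, x))"
    by auto
  show "prod.swap \<in> measurable (M \<Otimes>\<^sub>M M) (M \<Otimes>\<^sub>M M)"
    unfolding eq by (rule measurable_pair_swap')
  show "distr (M \<Otimes>\<^sub>M M) (M \<Otimes>\<^sub>M M) prod.swap = M \<Otimes>\<^sub>M M"
    unfolding eq by (rule distr_pair_swap[symmetric])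
qed

text \<open>
  An integral of \<open>h \<circ> d\<close> over any set is at most the integral of the positive part of \<open>h \<circ> d\<close>, which
  \<open>d\<close> preserves; hence images of sets under \<open>d\<close> need not be measurable.
\<close>

lemma integral_indicator_compose_le:
  fixes h :: "'a \<Rightarrow> real"
  assumes d: "d \<in> measurable M M" "distr M M d = M" and h: "integrable M h"
    and le: "\<And>A. A \<in> sets M \<Longrightarrow> (LINT x|M. indicator A x * h x) \<le> c"
    and E: "E \<in> sets M"
  shows "(LINT x|M. indicator E x * h (d x)) \<le> c"
proof -
  have [measurable]: "h \<in> borel_measurable M"
    using h by auto
  have "(LINT x|M. indicator E x * h (d x)) \<le> (LINT x|M. max 0 (h (d x)))"
    using integrable_compose_measure_preserving[OF d h]
      integrable_mult_indicator[OF E integrable_compose_measure_preserving[OF d h]]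
    by (intro integral_mono integrable_max) (auto simp: indicator_def)
  also have "\<dots> = (LINT x|M. max 0 (h x))"
    by (rule integral_compose_measure_preserving[OF d]) auto
  also have "\<dots> = (LINT x|M. indicator {x \<in> space M. 0 < h x} x * h x)"
    by (intro Bochner_Integration.integral_cong) (auto simp: indicator_def max_def)
  also have "\<dots> \<le> c"
    by (rule le) measurable
  finally show ?thesis .
qed

lemma abs_integral_indicator_compose_le:
  fixes h :: "'a \<Rightarrow> real"
  assumes d: "d \<in> measurable M M" "distr M M d = M" and h: "integrable M h"
    and le: "\<And>A. A \<in> sets M \<Longrightarrow> \<bar>LINT x|M. indicator A x * h x\<bar> \<le> c"
    and E: "E \<in> sets M"
  shows "\<bar>LINT x|M. indicator E x * h (d x)\<bar> \<le> c"
proof (rule abs_leI)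
  show "(LINT x|M. indicator E x * h (d x)) \<le> c"
    by (rule integral_indicator_compose_le[OF d h _ E]) (rule abs_le_D1[OF le])
  have "(LINT x|M. indicator E x * - h (d x)) \<le> c"
    by (rule integral_indicator_compose_le[OF d, where h="\<lambda>x. - h x"]) (use h E abs_le_D2[OF le] in auto)
  then show "- (LINT x|M. indicator E x * h (d x)) \<le> c"
    by simp
qed

text \<open>By Fubini the coordinates are handled one at a time: with one side of the rectangle
  fixed, the integral over the other coordinate is a one-variable problem for
  \<open>abs_integral_indicator_compose_le\<close>.\<close>

lemma (in finite_measure) abs_integral_rectangle_compose_le:
  fixes D :: "'a \<times> 'a \<Rightarrow> real"
  assumes D: "D \<in> borel_measurable (M \<Otimes>\<^sub>M M)" "\<And>p. p \<in> space (M \<Otimes>\<^sub>M M) \<Longrightarrow> \<bar>D p\<bar> \<le> K"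
    and d: "d \<in> measurable M M" "distr M M d = M"
    and le: "\<And>A B. A \<in> sets M \<Longrightarrow> B \<in> sets M \<Longrightarrow>
      \<bar>LINT p|(M \<Otimes>\<^sub>M M). indicator (A \<times> B) p * D p\<bar> \<le> c"
    and E: "E \<in> sets M" "F \<in> sets M"
  shows "\<bar>LINT p|(M \<Otimes>\<^sub>M M). indicator (E \<times> F) p * D (d (fst p), d (snd p))\<bar> \<le> c"
proof -
  interpret pair_sigma_finite M M ..
  interpret N: finite_measure "M \<Otimes>\<^sub>M M"
    by (intro finite_measure_pair_measure finite_measure_axioms)
  note [measurable] = D(1) d(1) E
  have int: "integrable (M \<Otimes>\<^sub>M M) (\<lambda>(x, y). indicator A x * (indicator B y * D (u x, v y)))"
    if [measurable]: "A \<in> sets M" "B \<in> sets M" "u \<in> measurable M M" "v \<in> measurable M M" for A B u v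
  proof (rule N.integrable_const_bound[of _ "\<bar>K\<bar>"])
    have "norm (indicator A x * (indicator B y * D (u x, v y))) \<le> \<bar>K\<bar>" if "x \<in> space M" "y \<in> space M" for x y
      using D(2)[of "(u x, v y)"] measurable_space[OF \<open>u \<in> measurable M M\<close>, of x]
        measurable_space[OF \<open>v \<in> measurable M M\<close>, of y] that
      by (auto simp: indicator_def space_pair_measure)
    then show "AE p in M \<Otimes>\<^sub>M M. norm (case p of (x, y) \<Rightarrow> indicator A x * (indicator B y * D (u x, v y))) \<le> \<bar>K\<bar>"
      by (auto simp: space_pair_measure intro!: AE_I2)
  qed measurable
  \<comment> \<open>General \<open>u\<close> and \<open>v\<close> cover the three cases used below:
    \<open>d\<close> composed into neither coordinate, into the second only, or into both.\<close>
  have fst_snd: "(LINT x|M. indicator A x * (LINT y|M. indicator B y * D (u x, v y)))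
      = (LINT p|(M \<Otimes>\<^sub>M M). indicator (A \<times> B) p * D (u (fst p), v (snd p)))"
    "(LINT y|M. indicator B y * (LINT x|M. indicator A x * D (u x, v y)))
      = (LINT p|(M \<Otimes>\<^sub>M M). indicator (A \<times> B) p * D (u (fst p), v (snd p)))"
    "integrable M (\<lambda>x. indicator A x * (LINT y|M. indicator B y * D (u x, v y)))"
    "integrable M (\<lambda>y. indicator B y * (LINT x|M. indicator A x * D (u x, v y)))"
    if A: "A \<in> sets M" "B \<in> sets M" "u \<in> measurable M M" "v \<in> measurable M M" for A B u v
  proof -
    have swap: "(LINT x|M. indicator A x * (indicator B y * D (u x, v y)))
        = indicator B y * (LINT x|M. indicator A x * D (u x, v y))" for y
      by (subst mult.left_commute) simp
    show "(LINT x|M. indicator A x * (LINT y|M. indicator B y * D (u x, v y)))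
        = (LINT p|(M \<Otimes>\<^sub>M M). indicator (A \<times> B) p * D (u (fst p), v (snd p)))"
      "(LINT y|M. indicator B y * (LINT x|M. indicator A x * D (u x, v y)))
        = (LINT p|(M \<Otimes>\<^sub>M M). indicator (A \<times> B) p * D (u (fst p), v (snd p)))"
      "integrable M (\<lambda>x. indicator A x * (LINT y|M. indicator B y * D (u x, v y)))"
      "integrable M (\<lambda>y. indicator B y * (LINT x|M. indicator A x * D (u x, v y)))"
      using integral_fst[OF int[OF A]] integral_snd[OF int[OF A]]
        integrable_fst[OF int[OF A]] integrable_snd[OF int[OF A]]
      by (simp_all add: case_prod_unfold indicator_times mult.assoc swap)
  qed
  have id: "(\<lambda>x. x) \<in> measurable M M"
    by simp
  \<comment> \<open>The first side \<open>A\<close> stays arbitrary, because the treatment of the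
    first coordinate needs the bound for all test sets.\<close>
  have *: "\<bar>LINT p|(M \<Otimes>\<^sub>M M). indicator (A \<times> F) p * D (fst p, d (snd p))\<bar> \<le> c" if A: "A \<in> sets M" for A
  proof -
    have "\<bar>LINT y|M. indicator F y * (LINT x|M. indicator A x * D (x, d y))\<bar> \<le> c"
    proof (rule abs_integral_indicator_compose_le[OF d])
      \<comment> \<open>With the whole space as test set, the outer indicator in
        \<open>fst_snd\<close> is 1 and drops out.\<close>
      show "integrable M (\<lambda>y. LINT x|M. indicator A x * D (x, y))"
        using fst_snd(4)[OF A sets.top id id] by (rule Bochner_Integration.integrable_cong[THEN iffD1, rotated 2]) auto
      show "\<bar>LINT y|M. indicator B y * (LINT x|M. indicator A x * D (x, y))\<bar> \<le> c" if "B \<in> sets M" for B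
        using fst_snd(2)[OF A that id id] le[OF A that] by simp
    qed fact
    then show ?thesis
      using fst_snd(2)[OF A E(2) id d(1)] by simp
  qed
  have "\<bar>LINT x|M. indicator E x * (LINT y|M. indicator F y * D (d x, d y))\<bar> \<le> c"
  proof (rule abs_integral_indicator_compose_le[OF d])
    show "integrable M (\<lambda>x. LINT y|M. indicator F y * D (x, d y))"
      using fst_snd(3)[OF sets.top E(2) id d(1)] by (rule Bochner_Integration.integrable_cong[THEN iffD1, rotated 2]) auto
    show "\<bar>LINT x|M. indicator A x * (LINT y|M. indicator F y * D (x, d y))\<bar> \<le> c" if "A \<in> sets M" for A
      using fst_snd(1)[OF that E(2) id d(1)] *[OF that] by simp
  qed fact
  then show ?thesis
    using fst_snd(1)[OF E d(1) d(1)] by simp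
qed

text \<open>Polarization; \<^const>\<open>cut_norm\<close> only tests squares \<open>A \<times> A\<close>.\<close>

lemma (in finite_measure) abs_integral_rectangle_le:
  fixes D :: "'a \<times> 'a \<Rightarrow> real"
  assumes D: "integrable (M \<Otimes>\<^sub>M M) D" and sym: "\<And>x y. D (x, y) = D (y, x)"
    and le: "\<And>A. A \<in> sets M \<Longrightarrow> \<bar>LINT p|(M \<Otimes>\<^sub>M M). indicator (A \<times> A) p * D p\<bar> \<le> c"
    and AB: "A \<in> sets M" "B \<in> sets M"
  shows "\<bar>LINT p|(M \<Otimes>\<^sub>M M). indicator (A \<times> B) p * D p\<bar> \<le> 6 * c"
proof -
  interpret pair_sigma_finite M M ..
  define b where "b X Y = (LINT p|(M \<Otimes>\<^sub>M M). indicator (X \<times> Y) p * D p)" for X Y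
  have int: "integrable (M \<Otimes>\<^sub>M M) (\<lambda>p. indicator (X \<times> Y) p * D p)" if "X \<in> sets M" "Y \<in> sets M" for X Y
    using integrable_real_mult_indicator[of "X \<times> Y" "M \<Otimes>\<^sub>M M" D] D that by (simp add: mult.commute)
  have commute: "b X Y = b Y X" if "X \<in> sets M" "Y \<in> sets M" for X Y
  proof -
    have "b Y X = (LINT (x, y)|(M \<Otimes>\<^sub>M M). indicator (Y \<times> X) (y, x) * D (y, x))"
      using integral_product_swap[OF borel_measurable_integrable[OF int[OF that(2,1)]]] by (simp add: b_def)
    also have "\<dots> = b X Y"
      unfolding b_def using sym
      by (intro Bochner_Integration.integral_cong) (auto simp: indicator_def)
    finally show ?thesis ..
  qed
  have add: "b (X \<union> Y) Z = b X Z + b Y Z" if "X \<inter> Y = {}" "X \<in> sets M" "Y \<in> sets M" "Z \<in> sets M" for X Y Z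
  proof -
    have "b (X \<union> Y) Z = (LINT p|(M \<Otimes>\<^sub>M M). indicator (X \<times> Z) p * D p + indicator (Y \<times> Z) p * D p)"
      unfolding b_def using that(1) by (intro Bochner_Integration.integral_cong) (auto simp: indicator_def)
    then show ?thesis
      unfolding b_def using int that by simp
  qed
  have add2: "b Z (X \<union> Y) = b Z X + b Z Y" if "X \<inter> Y = {}" "X \<in> sets M" "Y \<in> sets M" "Z \<in> sets M" for X Y Z
    using add[OF that] commute[of Z] that by simp
  have diag: "\<bar>b X X\<bar> \<le> c" if "X \<in> sets M" for X
    using le[OF that] by (simp add: b_def)
  \<comment> \<open>For disjoint sets the square of the union expands into the two squares plus
    twice the mixed term, so three square bounds control the latter.\<close>
  have disjoint: "2 * \<bar>b X Y\<bar> \<le> 3 * c" if "X \<inter> Y = {}" "X \<in> sets M" "Y \<in> sets M" for X Y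
  proof -
    have "b (X \<union> Y) (X \<union> Y) = b X X + 2 * b X Y + b Y Y"
      using that commute[OF that(2,3)] by (simp add: add add2)
    moreover have "\<bar>b (X \<union> Y) (X \<union> Y)\<bar> \<le> c" "\<bar>b X X\<bar> \<le> c" "\<bar>b Y Y\<bar> \<le> c"
      using that by (auto intro!: diag)
    ultimately show ?thesis
      by linarith
  qed
  let ?I = "A \<inter> B"
  have m: "?I \<in> sets M" "A - B \<in> sets M" "B - A \<in> sets M" "?I \<union> (B - A) \<in> sets M"
    using AB by auto
  have dj: "?I \<inter> (A - B) = {}" "?I \<inter> (B - A) = {}"
    by auto
  have "A = ?I \<union> (A - B)" "B = ?I \<union> (B - A)"
    by auto
  then have "b A B = b (?I \<union> (A - B)) (?I \<union> (B - A))"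
    by metis
  also have "\<dots> = b ?I ?I + b ?I (B - A) + (b (A - B) ?I + b (A - B) (B - A))"
    by (simp only: add[OF dj(1) m(1,2,4)] add2[OF dj(2) m(1,3,1)] add2[OF dj(2) m(1,3,2)])
  finally have "b A B = b ?I ?I + b ?I (B - A) + (b (A - B) ?I + b (A - B) (B - A))" .
  moreover have "\<bar>b ?I ?I\<bar> \<le> c" "2 * \<bar>b ?I (B - A)\<bar> \<le> 3 * c" "2 * \<bar>b (A - B) ?I\<bar> \<le> 3 * c"
    "2 * \<bar>b (A - B) (B - A)\<bar> \<le> 3 * c"
    using m by (auto intro!: diag disjoint)
  \<comment> \<open>The four terms add up to at most 11/2 times \<open>c\<close>; rounding up uses
    that \<open>c\<close>, a bound of absolute values, is nonnegative.\<close>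
  ultimately have "\<bar>b A B\<bar> \<le> 6 * c"
    by linarith
  then show ?thesis
    by (simp add: b_def)
qed

text \<open>Rectangles are stable under intersection and generate the product sigma-algebra, so the
  claim spreads by the Dynkin system principle. Since \<open>T n\<close> preserves the measure, the
  integrals are bounded by the measure of the set uniformly in \<open>n\<close>, which is what
  carries countable disjoint unions.\<close>

lemma tendsto_integral_indicator_compose:
  fixes Z :: "nat \<Rightarrow> 'a \<times> 'b \<Rightarrow> real"
  assumes fin: "finite_measure (M1 \<Otimes>\<^sub>M M2)"
    and T: "\<And>n. T n \<in> measurable (M1 \<Otimes>\<^sub>M M2) (M1 \<Otimes>\<^sub>M M2)"
      "\<And>n. distr (M1 \<Otimes>\<^sub>M M2) (M1 \<Otimes>\<^sub>M M2) (T n) = M1 \<Otimes>\<^sub>M M2"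
    and Z: "\<And>n. Z n \<in> borel_measurable (M1 \<Otimes>\<^sub>M M2)" "\<And>n p. p \<in> space (M1 \<Otimes>\<^sub>M M2) \<Longrightarrow> \<bar>Z n p\<bar> \<le> 1"
    and rect: "\<And>A B. A \<in> sets M1 \<Longrightarrow> B \<in> sets M2 \<Longrightarrow>
      (\<lambda>n. LINT p|(M1 \<Otimes>\<^sub>M M2). indicator (A \<times> B) (T n p) * Z n p) \<longlonglongrightarrow> 0"
    and S: "S \<in> sets (M1 \<Otimes>\<^sub>M M2)"
  shows "(\<lambda>n. LINT p|(M1 \<Otimes>\<^sub>M M2). indicator S (T n p) * Z n p) \<longlonglongrightarrow> 0"
proof -
  let ?N = "M1 \<Otimes>\<^sub>M M2"
  interpret finite_measure ?N by fact
  note [measurable] = T(1) Z(1)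
  define a where "a n X = (LINT p|?N. indicator X (T n p) * Z n p)" for n X
  have int: "integrable ?N (\<lambda>p. indicator X (T n p) * Z n p)" if [measurable]: "X \<in> sets ?N" for n X
    using Z(2) by (intro integrable_const_bound[of _ 1]) (auto simp: indicator_def)
  have bound: "\<bar>a n X\<bar> \<le> measure ?N X" if [measurable]: "X \<in> sets ?N" for n X
  proof -
    have "\<bar>a n X\<bar> \<le> (LINT p|?N. \<bar>indicator X (T n p) * Z n p\<bar>)"
      unfolding a_def by (rule integral_abs_bound)
    also have "\<dots> \<le> (LINT p|?N. indicator X (T n p))"
      using Z(2) int[OF that, of n]
      by (intro integral_mono integrable_abs integrable_const_bound[where B=1]) (auto simp: indicator_def)
    also have "\<dots> = (LINT p|distr ?N ?N (T n). indicator X p)"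
      by (rule integral_distr[symmetric]) auto
    also have "\<dots> = measure ?N X"
      using that by (simp add: T(2))
    finally show ?thesis .
  qed
  have a_Un: "a n (X \<union> Y) = a n X + a n Y" if "X \<inter> Y = {}" "X \<in> sets ?N" "Y \<in> sets ?N" for n X Y
  proof -
    have "a n (X \<union> Y) = (LINT p|?N. indicator X (T n p) * Z n p + indicator Y (T n p) * Z n p)"
      unfolding a_def using that(1) by (intro Bochner_Integration.integral_cong) (auto simp: indicator_def)
    then show ?thesis
      unfolding a_def using int that by simp
  qed
  have top: "(\<lambda>n. a n (space M1 \<times> space M2)) \<longlonglongrightarrow> 0"
    unfolding a_def by (intro rect) auto
  have "(\<lambda>n. a n S) \<longlonglongrightarrow> 0"
    using Int_stable_pair_measure_generator pair_measure_closed S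
    unfolding sets_pair_measure
  proof (induct rule: sigma_sets_induct_disjoint)
    case (basic X)
    then show ?case
      unfolding a_def using rect by auto
  next
    case empty
    then show ?case
      by (simp add: a_def)
  next
    case (compl X)
    then have X: "X \<in> sets ?N"
      by (simp add: sets_pair_measure)
    let ?top = "space M1 \<times> space M2"
    have "X \<subseteq> ?top"
      using sets.sets_into_space[OF X] by (simp add: space_pair_measure)
    then have "X \<union> (?top - X) = ?top"
      by auto
    then have "a n (?top - X) = a n ?top - a n X" for n
      using a_Un[of X "?top - X" n] X by auto
    then show ?case
      using tendsto_diff[OF top compl(2)] by simp
  next
    case (union X)
    then have X [measurable]: "X i \<in> sets ?N" for i
      by (auto simp: sets_pair_measure)
    \<comment> \<open>Finitely many members converge one by one; the remainder is controlled by the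
      measure of the tail, which tends to 0.\<close>
    define tail where "tail k = (\<Union>i\<in>{k..}. X i)" for k
    have tail [measurable]: "tail k \<in> sets ?N" for k
      unfolding tail_def by (rule sets.countable_UN') (auto intro: X)
    have split: "a n (\<Union>i. X i) = (\<Sum>i<k. a n (X i)) + a n (tail k)" for n k
    proof (induction k)
      case 0
      then show ?case
        by (simp add: tail_def)
    next
      case (Suc k)
      have "{k..} = insert k {Suc k..}"
        by auto
      then have "tail k = X k \<union> tail (Suc k)"
        by (simp add: tail_def)
      moreover have "X k \<inter> tail (Suc k) = {}"
      proof -
        have "X k \<inter> X j = {}" if "Suc k \<le> j" for j
          using \<open>disjoint_family X\<close> that by (intro disjoint_family_onD) auto
        then show ?thesis
          by (auto simp: tail_def)
      qed
      ultimately have "a n (tail k) = a n (X k) + a n (tail (Suc k))"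
        by (simp add: a_Un)
      then show ?case
        using Suc by simp
    qed
    have "(\<lambda>k. measure ?N (tail k)) \<longlonglongrightarrow> measure ?N (\<Inter>k. tail k)"
    proof (rule finite_Lim_measure_decseq)
      show "decseq tail"
        unfolding decseq_def tail_def by (intro allI impI UN_mono) auto
    qed auto
    moreover have "(\<Inter>k. tail k) = {}"
    proof (rule ccontr)
      assume "(\<Inter>k. tail k) \<noteq> {}"
      then obtain x where x: "\<And>k. x \<in> tail k"
        by auto
      obtain i where "x \<in> X i"
        using x[of 0] by (auto simp: tail_def)
      moreover obtain j where "j \<ge> Suc i" "x \<in> X j"
        using x[of "Suc i"] by (auto simp: tail_def)
      ultimately show False
        using disjoint_family_onD[OF \<open>disjoint_family X\<close>, of i j] by auto
    qed
    ultimately have tail_0: "(\<lambda>k. measure ?N (tail k)) \<longlonglongrightarrow> 0"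
      by simp
    show ?case
    proof (rule LIMSEQ_I)
      fix e :: real assume e: "0 < e"
      \<comment> \<open>The index \<open>k\<close> is fixed first: the tail bound holds for all
        \<open>n\<close> at once.\<close>
      obtain k where k: "measure ?N (tail k) < e / 2"
        using LIMSEQ_D[OF tail_0, of "e / 2"] e by auto
      have "(\<lambda>n. \<Sum>i<k. a n (X i)) \<longlonglongrightarrow> (\<Sum>i<k. 0)"
        by (intro tendsto_sum union(3))
      then have "(\<lambda>n. \<Sum>i<k. a n (X i)) \<longlonglongrightarrow> 0"
        by simp
      from LIMSEQ_D[OF this, of "e / 2"] e
      obtain n0 where n0: "\<And>n. n \<ge> n0 \<Longrightarrow> \<bar>\<Sum>i<k. a n (X i)\<bar> < e / 2"
        by auto
      show "\<exists>no. \<forall>n\<ge>no. norm (a n (\<Union> (range X)) - 0) < e"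
      proof (intro exI allI impI)
        fix n assume "n \<ge> n0"
        then show "norm (a n (\<Union> (range X)) - 0) < e"
          using n0[of n] k bound[OF tail[of k], of n] split[of n k] by simp
      qed
    qed
  qed
  then show ?thesis
    by (simp add: a_def)
qed

section \<open>Cut-norm limits\<close>

text \<open>Midpoint concavity is integrated pointwise; the swap of coordinates preserves the
  product measure, so both halves contribute the same integral.\<close>

lemma (in finite_measure) integral_concave_le_symmetrized:
  fixes f :: "real \<Rightarrow> real"
  assumes S: "compact S" and f: "concave_on S f" "continuous_on S f"
    and W: "W \<in> borel_measurable (M \<Otimes>\<^sub>M M)" "\<And>p. W p \<in> S"
  shows "(LINT p|(M \<Otimes>\<^sub>M M). f (W p)) \<le> (LINT p|(M \<Otimes>\<^sub>M M). f ((W p + W (prod.swap p)) / 2))"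
proof -
  interpret N: finite_measure "M \<Otimes>\<^sub>M M"
    by (intro finite_measure_pair_measure finite_measure_axioms)
  note [measurable] = W(1) measure_preserving_swap(1)
  have swap: "(\<lambda>p. W (prod.swap p)) \<in> borel_measurable (M \<Otimes>\<^sub>M M)"
    by measurable
  have mid: "(W p + W (prod.swap p)) / 2 \<in> S" "(f (W p) + f (W (prod.swap p))) / 2 \<le> f ((W p + W (prod.swap p)) / 2)" for p
  proof -
    have "convex S"
      using f(1) by (rule concave_on_imp_convex)
    from convexD[OF this W(2)[of p] W(2)[of "prod.swap p"], of "1/2" "1/2"]
    show "(W p + W (prod.swap p)) / 2 \<in> S"
      by (simp add: field_simps)
    from concave_onD[OF f(1), of "1/2" "W p" "W (prod.swap p)"] W(2)
    show "(f (W p) + f (W (prod.swap p))) / 2 \<le> f ((W p + W (prod.swap p)) / 2)"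
      by (simp add: field_simps)
  qed
  have int: "integrable (M \<Otimes>\<^sub>M M) (\<lambda>p. f (W p))" "integrable (M \<Otimes>\<^sub>M M) (\<lambda>p. f (W (prod.swap p)))"
    using N.integrable_continuous_compose[OF S f(2) W] N.integrable_continuous_compose[OF S f(2) swap W(2)]
    by simp_all
  have "(LINT p|(M \<Otimes>\<^sub>M M). f (W (prod.swap p))) = (LINT p|(M \<Otimes>\<^sub>M M). f (W p))"
    by (rule integral_compose_measure_preserving[OF measure_preserving_swap])
      (use int in auto)
  then have "(LINT p|(M \<Otimes>\<^sub>M M). f (W p)) = (LINT p|(M \<Otimes>\<^sub>M M). (f (W p) + f (W (prod.swap p))) / 2)"
    using int by simp
  also have "\<dots> \<le> (LINT p|(M \<Otimes>\<^sub>M M). f ((W p + W (prod.swap p)) / 2))"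
    using int mid N.integrable_continuous_compose[OF S f(2) _ mid(1)]
    by (intro integral_mono) auto
  finally show ?thesis .
qed

text \<open>The comparison is carried out for representatives that are product measurable and take
  values in the unit interval everywhere. \<open>G n\<close> stands for the versions tending to
  \<open>U\<close> and \<open>H n\<close> for those tending to \<open>W\<close>; \<open>GH\<close>
  makes them rearrangements of a common kernel.\<close>

lemma (in finite_measure) integral_concave_le_of_cut_limit:
  fixes f :: "real \<Rightarrow> real" and G H :: "nat \<Rightarrow> 'a \<times> 'a \<Rightarrow> real"
  assumes f: "concave_on {0..1} f" "continuous_on {0..1} f"
    and U: "U \<in> borel_measurable (M \<Otimes>\<^sub>M M)" "\<And>p. U p \<in> {0..1}"
    and W: "W \<in> borel_measurable (M \<Otimes>\<^sub>M M)" "\<And>p. W p \<in> {0..1}"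
    and G: "\<And>n. G n \<in> borel_measurable (M \<Otimes>\<^sub>M M)" "\<And>n p. G n p \<in> {0..1}"
    and H: "\<And>n. H n \<in> borel_measurable (M \<Otimes>\<^sub>M M)" "\<And>n p. H n p \<in> {0..1}" "\<And>n x y. H n (x, y) = H n (y, x)"
    and g: "\<And>n. g n \<in> measurable M M" "\<And>n. distr M M (g n) = M"
    and d: "\<And>n. d n \<in> measurable M M" "\<And>n. distr M M (d n) = M"
    and GH: "\<And>n. AE p in M \<Otimes>\<^sub>M M. G n (g n (fst p), g n (snd p)) = H n (d n (fst p), d n (snd p))"
    and weak: "\<And>A. A \<in> sets (M \<Otimes>\<^sub>M M) \<Longrightarrow>
      (\<lambda>n. LINT p|(M \<Otimes>\<^sub>M M). indicator A p * G n p) \<longlonglongrightarrow> (LINT p|(M \<Otimes>\<^sub>M M). indicator A p * U p)"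
    and cut: "\<And>n A. A \<in> sets M \<Longrightarrow> \<bar>LINT p|(M \<Otimes>\<^sub>M M). indicator (A \<times> A) p * (H n p - W p)\<bar> \<le> c n"
      "c \<longlonglongrightarrow> 0"
  shows "(LINT p|(M \<Otimes>\<^sub>M M). f (W p)) \<le> (LINT p|(M \<Otimes>\<^sub>M M). f (U p))"
proof -
  let ?N = "M \<Otimes>\<^sub>M M"
  have sf: "sigma_finite_measure M" ..
  interpret N: finite_measure ?N
    by (intro finite_measure_pair_measure finite_measure_axioms)
  define T where "T n p = (g n (fst p), g n (snd p))" for n p
  define R where "R n p = (d n (fst p), d n (snd p))" for n p
  have T: "T n \<in> measurable ?N ?N" "distr ?N ?N (T n) = ?N" for n
    using measure_preserving_pair[OF sf g] unfolding T_def by auto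
  have R: "R n \<in> measurable ?N ?N" "distr ?N ?N (R n) = ?N" for n
    using measure_preserving_pair[OF sf d] unfolding R_def by auto
  \<comment> \<open>Polarization requires a symmetric difference, hence the symmetrized
    \<open>W\<close>.\<close>
  define W' where "W' p = (W p + W (prod.swap p)) / 2" for p
  define D where "D n p = H n p - W' p" for n p
  note [measurable] = U(1) W(1) G(1) H(1) g(1) d(1) T(1) R(1) measure_preserving_swap(1)
  have [measurable]: "W' \<in> borel_measurable ?N"
    unfolding W'_def by measurable
  have [measurable]: "D n \<in> borel_measurable ?N" for n
    unfolding D_def by measurable
  have W': "W' p \<in> {0..1}" for p
    using W(2)[of p] W(2)[of "prod.swap p"] by (auto simp: W'_def)
  have D_bound: "\<bar>D n p\<bar> \<le> 1" for n p
    using H(2)[of n p] W'[of p] by (auto simp: D_def)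
  have bounded_int: "integrable ?N h" if "h \<in> borel_measurable ?N" "\<And>p. \<bar>h p\<bar> \<le> 1" for h :: "'a \<times> 'a \<Rightarrow> real"
    using that by (intro N.integrable_const_bound[of _ 1]) auto
  have W_bound: "\<bar>W p\<bar> \<le> 1" "\<bar>H n p\<bar> \<le> 1" for n p
    using W(2)[of p] H(2)[of n p] by auto
  \<comment> \<open>Squares are invariant under the swap, so symmetrizing \<open>W\<close> leaves
    the integrals over them unchanged.\<close>
  have D_square: "\<bar>LINT p|?N. indicator (A \<times> A) p * D n p\<bar> \<le> c n" if A [measurable]: "A \<in> sets M" for A n
  proof -
    have int: "integrable ?N (\<lambda>p. indicator (A \<times> A) p * W p)" "integrable ?N (\<lambda>p. indicator (A \<times> A) p * H n p)"
      using W_bound by (auto intro!: bounded_int simp: indicator_def)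
    have swap: "indicator (A \<times> A) p = (indicator (A \<times> A) (prod.swap p) :: real)" for p
      by (cases p) (auto simp: indicator_def)
    have int': "integrable ?N (\<lambda>p. indicator (A \<times> A) p * W (prod.swap p))"
      using integrable_compose_measure_preserving[OF measure_preserving_swap int(1)] by (simp add: swap[symmetric])
    have "(LINT p|?N. indicator (A \<times> A) p * W (prod.swap p)) = (LINT p|?N. indicator (A \<times> A) p * W p)"
      using integral_compose_measure_preserving[OF measure_preserving_swap borel_measurable_integrable[OF int(1)]]
      by (simp add: swap[symmetric])
    moreover have "(LINT p|?N. indicator (A \<times> A) p * D n p) = (LINT p|?N. indicator (A \<times> A) p * H n p
        - (indicator (A \<times> A) p * W p + indicator (A \<times> A) p * W (prod.swap p)) / 2)"
      by (intro Bochner_Integration.integral_cong) (auto simp: D_def W'_def algebra_simps add_divide_distrib)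
    moreover have "(LINT p|?N. indicator (A \<times> A) p * (H n p - W p))
        = (LINT p|?N. indicator (A \<times> A) p * H n p) - (LINT p|?N. indicator (A \<times> A) p * W p)"
      using int by (simp add: right_diff_distrib)
    ultimately have "(LINT p|?N. indicator (A \<times> A) p * D n p) = (LINT p|?N. indicator (A \<times> A) p * (H n p - W p))"
      using int int' by simp
    then show ?thesis
      using cut(1)[OF A, of n] by simp
  qed
  \<comment> \<open>Polarization gives \<open>6 * c n\<close> on all rectangles, and composing both
    coordinates with \<open>d n\<close> keeps that bound.\<close>
  have D_rect: "\<bar>LINT p|?N. indicator (A \<times> B) p * D n (R n p)\<bar> \<le> 6 * c n" if "A \<in> sets M" "B \<in> sets M" for A B n
    unfolding R_def
  proof (rule abs_integral_rectangle_compose_le[OF _ _ d _ that])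
    show "\<bar>LINT p|?N. indicator (X \<times> Y) p * D n p\<bar> \<le> 6 * c n" if "X \<in> sets M" "Y \<in> sets M" for X Y
      using D_square D_bound H(3) by (intro abs_integral_rectangle_le that) (auto simp: D_def W'_def intro!: bounded_int)
  qed (use D_bound in auto)
  have "(\<lambda>n. LINT p|?N. indicator A (T n p) * D n (R n p)) \<longlonglongrightarrow> 0" if "A \<in> sets ?N" for A
  proof (rule tendsto_integral_indicator_compose[OF N.finite_measure_axioms T _ _ _ that])
    fix A B assume AB: "A \<in> sets M" "B \<in> sets M"
    \<comment> \<open>\<open>T n\<close> acts on each coordinate separately, so the preimage of a
      rectangle is again a rectangle.\<close>
    have *: "\<bar>LINT p|?N. indicator (A \<times> B) (T n p) * D n (R n p)\<bar> \<le> 6 * c n" for n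
    proof -
      have "(LINT p|?N. indicator (A \<times> B) (T n p) * D n (R n p))
          = (LINT p|?N. indicator ((g n -` A \<inter> space M) \<times> (g n -` B \<inter> space M)) p * D n (R n p))"
        by (intro Bochner_Integration.integral_cong) (auto simp: T_def indicator_def space_pair_measure)
      then show ?thesis
        using D_rect measurable_sets[OF g(1)] AB by simp
    qed
    show "(\<lambda>n. LINT p|?N. indicator (A \<times> B) (T n p) * D n (R n p)) \<longlonglongrightarrow> 0"
    proof (rule Lim_null_comparison)
      show "\<forall>\<^sub>F n in sequentially. norm (LINT p|?N. indicator (A \<times> B) (T n p) * D n (R n p)) \<le> 6 * c n"
        using * by (intro always_eventually) auto
      show "(\<lambda>n. 6 * c n) \<longlonglongrightarrow> 0"
        using tendsto_mult_right_zero[OF cut(2)] by simp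
    qed
  qed (use D_bound in auto)
  note D_lim = this
  have "(LINT p|?N. f (W' p)) \<le> (LINT p|?N. f (U p))"
  proof (rule N.integral_concave_le_weak_limit[OF compact_Icc f U _ _ T R])
    fix A assume A [measurable]: "A \<in> sets ?N"
    \<comment> \<open>\<open>W'\<close> is \<open>H n\<close> minus \<open>D n\<close>, and
      \<open>H n (R n p)\<close> agrees almost everywhere with \<open>G n (T n p)\<close>; as
      \<open>T n\<close> preserves the measure, this part is the integral of \<open>G n\<close> over
      \<open>A\<close>.\<close>
    have "(LINT p|?N. indicator A (T n p) * W' (R n p))
        = (LINT p|?N. indicator A p * G n p) - (LINT p|?N. indicator A (T n p) * D n (R n p))" for n
    proof -
      have int: "integrable ?N (\<lambda>p. indicator A (T n p) * H n (R n p))"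
          "integrable ?N (\<lambda>p. indicator A (T n p) * D n (R n p))"
        by (auto intro!: bounded_int W_bound D_bound simp: indicator_def)
      have "(LINT p|?N. indicator A p * G n p) = (LINT p|?N. indicator A (T n p) * G n (T n p))"
        by (rule integral_compose_measure_preserving[OF T, symmetric]) measurable
      also have "\<dots> = (LINT p|?N. indicator A (T n p) * H n (R n p))"
        using GH[of n] by (intro integral_cong_AE) (auto simp: T_def[symmetric] R_def[symmetric])
      finally have "(LINT p|?N. indicator A p * G n p) - (LINT p|?N. indicator A (T n p) * D n (R n p))
          = (LINT p|?N. indicator A (T n p) * H n (R n p) - indicator A (T n p) * D n (R n p))"
        using int by simp
      also have "\<dots> = (LINT p|?N. indicator A (T n p) * W' (R n p))"
        by (intro Bochner_Integration.integral_cong) (auto simp: D_def algebra_simps)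
      finally show ?thesis ..
    qed
    then show "(\<lambda>n. LINT p|?N. indicator A (T n p) * W' (R n p)) \<longlonglongrightarrow> (LINT p|?N. indicator A p * U p)"
      using tendsto_diff[OF weak[OF A] D_lim[OF A]] by simp
  qed (use W' in auto)
  then show ?thesis
    using integral_concave_le_symmetrized[OF compact_Icc f W] by (simp add: W'_def)
qed

section \<open>Kernels on the unit square\<close>

text \<open>The product of the completed intervals, not the completed square: Fubini applies to it,
  and its sigma-algebra lies between the Borel and the Lebesgue sets of the square.\<close>

abbreviation unit_leb_pair :: "(real \<times> real) measure" where
  "unit_leb_pair \<equiv> unit_leb \<Otimes>\<^sub>M unit_leb"

interpretation unit_leb: finite_measure unit_leb
  by (rule finite_measure_lebesgue_on) auto

interpretation unit_leb_pair: pair_sigma_finite unit_leb unit_leb ..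

interpretation unit_leb_pair: finite_measure unit_leb_pair
  by (intro finite_measure_pair_measure unit_leb.finite_measure_axioms)

lemma unit_leb_eq_completion: "unit_leb = completion (restrict_space lborel {0..1})"
  by (rule completion_restrict_space) auto

text \<open>The Lebesgue square completes the product whose factors are completed in
  \<open>unit_leb_pair\<close>, so the general facts on completions of products apply.\<close>

lemma unit_square_leb_eq_completion:
  "unit_square_leb = completion (restrict_space lborel {0..1} \<Otimes>\<^sub>M restrict_space lborel {0..1})"
proof -
  have "restrict_space lborel {0..1::real} \<Otimes>\<^sub>M restrict_space lborel {0..1::real}
      = restrict_space (lborel :: (real \<times> real) measure) ({0..1} \<times> {0..1})"
    using restrict_space_pair_measure[OF lborel.sigma_finite_measure_axioms lborel.sigma_finite_measure_axioms,
      of "{0..1::real}" "{0..1::real}"]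
    by (simp add: lborel_prod)
  moreover have "restrict_space (completion lborel) ({0..1::real} \<times> {0..1::real})
      = completion (restrict_space lborel ({0..1} \<times> {0..1}))"
    by (rule completion_restrict_space) (auto simp: borel_prod[symmetric])
  ultimately show ?thesis
    by simp
qed

lemma sigma_finite_restrict_lborel: "sigma_finite_measure (restrict_space lborel {0..1::real})"
  by (intro sigma_finite_measure_restrict_space lborel.sigma_finite_measure_axioms) auto

lemma measurable_unit_square_leb: "(\<lambda>p. p) \<in> measurable unit_square_leb unit_leb_pair"
  unfolding unit_leb_eq_completion unit_square_leb_eq_completion
  by (rule measurable_completion_pair[OF sigma_finite_restrict_lborel])

lemma distr_unit_square_leb: "distr unit_square_leb unit_leb_pair (\<lambda>p. p) = unit_leb_pair"
  unfolding unit_leb_eq_completion unit_square_leb_eq_completion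
  by (rule distr_completion_pair[OF sigma_finite_restrict_lborel sigma_finite_restrict_lborel])

lemma AE_unit_square_leb_iff: "(AE p in unit_square_leb. P p) \<longleftrightarrow> (AE p in unit_leb_pair. P p)"
  unfolding unit_leb_eq_completion unit_square_leb_eq_completion
  by (simp add: AE_completion_iff AE_completion_pair_iff[OF sigma_finite_restrict_lborel sigma_finite_restrict_lborel])

text \<open>A function measurable for a completed measure agrees almost everywhere with one
  measurable before completion. Clamping the latter to the unit interval makes the range condition
  hold everywhere, also off the square.\<close>

lemma unit_valued_kernel_representative:
  assumes "unit_valued_kernel W"
  obtains W' where "W' \<in> borel_measurable unit_leb_pair" "\<And>p. W' p \<in> {0..1}"
    "AE p in unit_leb_pair. W p = W' p"
proof -
  have "W \<in> borel_measurable unit_square_leb"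
    using assms by (simp add: unit_valued_kernel_def)
  then obtain h where h: "h \<in> borel_measurable (restrict_space lborel {0..1} \<Otimes>\<^sub>M restrict_space lborel {0..1})"
      "AE p in restrict_space lborel {0..1} \<Otimes>\<^sub>M restrict_space lborel {0..1}. W p = h p"
    using completion_ex_borel_measurable_real unfolding unit_square_leb_eq_completion by blast
  have [measurable]: "h \<in> borel_measurable unit_leb_pair"
    using measurable_compose[OF measurable_pair_completion h(1)] by (simp add: unit_leb_eq_completion)
  have "AE p in unit_leb_pair. W p = h p"
    using h(2) unfolding unit_leb_eq_completion
    by (simp add: AE_completion_pair_iff[OF sigma_finite_restrict_lborel sigma_finite_restrict_lborel])
  then have "AE p in unit_leb_pair. W p = max 0 (min 1 (h p))"
    using AE_space
  proof eventually_elim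
    case (elim p)
    then have "fst p \<in> {0..1}" "snd p \<in> {0..1}"
      by (auto simp: space_pair_measure)
    then have "W (fst p, snd p) \<in> {0..1}"
      using assms unfolding unit_valued_kernel_def by blast
    then have "W p \<in> {0..1}"
      by simp
    then show ?case
      using elim by (auto simp: min_def max_def)
  qed
  then show thesis
    by (intro that[of "\<lambda>p. max 0 (min 1 (h p))"]) auto
qed

text \<open>Averaging a representative with its swap makes it symmetric everywhere. It still
  represents \<open>W\<close>, because \<open>W\<close> is symmetric and the swap preserves the
  measure.\<close>

lemma graphon_representative:
  assumes "graphon W"
  obtains W' where "W' \<in> borel_measurable unit_leb_pair" "\<And>p. W' p \<in> {0..1}"
    "\<And>x y. W' (x, y) = W' (y, x)" "AE p in unit_leb_pair. W p = W' p"
proof -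
  have "unit_valued_kernel W"
    using assms by (simp add: graphon_def)
  then obtain h where h: "h \<in> borel_measurable unit_leb_pair" "\<And>p. h p \<in> {0..1}" "AE p in unit_leb_pair. W p = h p"
    by (rule unit_valued_kernel_representative) blast
  note [measurable] = h(1) unit_leb.measure_preserving_swap(1)
  have "AE p in unit_leb_pair. W (prod.swap p) = h (prod.swap p)"
    by (rule AE_compose_measure_preserving[OF unit_leb.measure_preserving_swap h(3)])
  then have "AE p in unit_leb_pair. W p = (h p + h (prod.swap p)) / 2"
    using h(3) AE_space
  proof eventually_elim
    case (elim p)
    then have "W (prod.swap p) = W p"
      using assms by (cases p) (auto simp: graphon_def space_pair_measure)
    then show ?case
      using elim by simp
  qed
  moreover have "(h p + h (prod.swap p)) / 2 \<in> {0..1}" for p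
    using h(2)[of p] h(2)[of "prod.swap p"] by auto
  ultimately show thesis
    by (intro that[of "\<lambda>p. (h p + h (prod.swap p)) / 2"]) (auto simp: add.commute)
qed

lemma integral_unit_square_leb:
  assumes "V \<in> borel_measurable unit_square_leb" "V' \<in> borel_measurable unit_leb_pair"
    and "AE p in unit_leb_pair. V p = V' p"
  shows "(LINT p|unit_square_leb. V p :: real) = (LINT p|unit_leb_pair. V' p)"
proof -
  have "(LINT p|unit_square_leb. V p) = (LINT p|unit_square_leb. V' p)"
    using assms measurable_compose[OF measurable_unit_square_leb assms(2)]
    by (intro integral_cong_AE) (auto simp: AE_unit_square_leb_iff)
  also have "\<dots> = (LINT p|distr unit_square_leb unit_leb_pair (\<lambda>p. p). V' p)"
    by (rule integral_distr[OF measurable_unit_square_leb assms(2), symmetric])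
  finally show ?thesis
    by (simp add: distr_unit_square_leb)
qed

section \<open>Iterated integrals and the cut norm as integrals over the product\<close>

lemma integral_unit_leb_cong_AE:
  fixes g h :: "real \<Rightarrow> real"
  assumes "h \<in> borel_measurable unit_leb" and "AE x in unit_leb. g x = h x"
  shows "(LINT x|unit_leb. g x) = (LINT x|unit_leb. h x)"
  using assms unfolding unit_leb_eq_completion by (rule integral_completion_cong_AE)

text \<open>\<open>V\<close> itself need not be product measurable. Almost all of its sections agree
  almost everywhere with those of \<open>V'\<close>, and completeness of \<open>unit_leb\<close>
  lets the inner and then the outer integral be replaced.\<close>

lemma iterated_integral_unit_leb:
  fixes V :: "real \<times> real \<Rightarrow> real"
  assumes V': "integrable unit_leb_pair V'" and eq: "AE p in unit_leb_pair. V p = V' p"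
  shows "(LINT x|unit_leb. LINT y|unit_leb. V (x, y)) = (LINT p|unit_leb_pair. V' p)"
proof -
  have [measurable]: "V' \<in> borel_measurable unit_leb_pair"
    using V' by auto
  have "AE x in unit_leb. AE y in unit_leb. V (x, y) = V' (x, y)"
    using unit_leb_pair.AE_pair[OF eq] .
  then have inner: "AE x in unit_leb. (LINT y|unit_leb. V (x, y)) = (LINT y|unit_leb. V' (x, y))"
    using AE_space
  proof eventually_elim
    case (elim x)
    have "(\<lambda>y. V' (x, y)) \<in> borel_measurable unit_leb"
      using elim(2) by measurable
    then show ?case
      using elim(1) by (rule integral_unit_leb_cong_AE)
  qed
  have "(\<lambda>x. LINT y|unit_leb. V' (x, y)) \<in> borel_measurable unit_leb"
    by measurable
  then have "(LINT x|unit_leb. LINT y|unit_leb. V (x, y)) = (LINT x|unit_leb. LINT y|unit_leb. V' (x, y))"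
    using inner by (rule integral_unit_leb_cong_AE)
  also have "\<dots> = (LINT p|unit_leb_pair. V' p)"
    by (rule unit_leb_pair.integral_fst'[OF V'])
  finally show ?thesis .
qed

lemma INT_fun_eq_integral:
  assumes "continuous_on {0..1} f" "W' \<in> borel_measurable unit_leb_pair" "\<And>p. W' p \<in> {0..1}"
    "AE p in unit_leb_pair. W p = W' p"
  shows "INT_fun f W = (LINT p|unit_leb_pair. f (W' p))"
  unfolding INT_fun_def
  using assms(4)
  by (intro iterated_integral_unit_leb[where V="\<lambda>p. f (W p)"]
      unit_leb_pair.integrable_continuous_compose[OF compact_Icc assms(1-3)])
    (auto elim!: eventually_mono)

lemma set_integral_unit_leb:
  fixes h :: "real \<Rightarrow> real"
  assumes "A \<in> sets unit_leb"
  shows "(LINT x:A|lebesgue. h x) = (LINT x|unit_leb. indicator A x * h x)"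
proof -
  have "A \<subseteq> {0..1}"
    using sets.sets_into_space[OF assms] by simp
  have "(LINT x|unit_leb. indicator A x * h x) = (LINT x|lebesgue. indicator {0..1} x *\<^sub>R (indicator A x * h x))"
    by (rule integral_restrict_space) auto
  also have "\<dots> = (LINT x|lebesgue. indicator A x *\<^sub>R h x)"
    using \<open>A \<subseteq> {0..1}\<close> by (intro Bochner_Integration.integral_cong) (auto simp: indicator_def)
  finally show ?thesis
    by (simp add: set_lebesgue_integral_def)
qed

lemma abs_integral_square_le_cut_norm:
  fixes V :: "real \<times> real \<Rightarrow> real"
  assumes V': "V' \<in> borel_measurable unit_leb_pair" "\<And>p. \<bar>V' p\<bar> \<le> 1"
    and eq: "AE p in unit_leb_pair. V p = V' p"
    and A: "A \<in> sets unit_leb"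
  shows "\<bar>LINT p|unit_leb_pair. indicator (A \<times> A) p * V' p\<bar> \<le> cut_norm V"
proof -
  note [measurable] = V'(1)
  have int: "integrable unit_leb_pair (\<lambda>p. indicator (B \<times> B) p * V' p)" if [measurable]: "B \<in> sets unit_leb" for B
    using V'(2) by (intro unit_leb_pair.integrable_const_bound[of _ 1]) (auto simp: indicator_def)
  have iter: "(LINT x:B|lebesgue. LINT y:B|lebesgue. V (x, y)) = (LINT p|unit_leb_pair. indicator (B \<times> B) p * V' p)"
    if B: "B \<in> sets unit_leb" for B
  proof -
    have "(LINT x:B|lebesgue. LINT y:B|lebesgue. V (x, y))
        = (LINT x|unit_leb. LINT y|unit_leb. indicator (B \<times> B) (x, y) * V (x, y))"
      by (simp add: set_integral_unit_leb[OF B] indicator_times mult.assoc)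
    also have "\<dots> = (LINT p|unit_leb_pair. indicator (B \<times> B) p * V' p)"
      by (rule iterated_integral_unit_leb[OF int[OF B]]) (use eq in \<open>auto elim!: eventually_mono\<close>)
    finally show ?thesis .
  qed
  \<comment> \<open>A real supremum is known to dominate its members only for a family bounded
    above; the total mass is such a bound.\<close>
  have bound: "\<bar>LINT x:B|lebesgue. LINT y:B|lebesgue. V (x, y)\<bar> \<le> measure unit_leb_pair (space unit_leb_pair)"
    if B: "B \<in> sets unit_leb" for B
  proof -
    have "\<bar>LINT p|unit_leb_pair. indicator (B \<times> B) p * V' p\<bar> \<le> (LINT p|unit_leb_pair. \<bar>indicator (B \<times> B) p * V' p\<bar>)"
      by (rule integral_abs_bound)
    also have "\<dots> \<le> (LINT p|unit_leb_pair. 1)"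
      using int[OF B] V'(2) by (intro integral_mono integrable_abs) (auto simp: indicator_def)
    finally show ?thesis
      by (simp add: iter[OF B])
  qed
  have "\<bar>LINT x:A|lebesgue. LINT y:A|lebesgue. V (x, y)\<bar> \<le> cut_norm V"
    unfolding cut_norm_def
    by (rule cSUP_upper[OF A]) (use bound in \<open>auto intro!: bdd_aboveI2\<close>)
  then show ?thesis
    by (simp add: iter[OF A])
qed

text \<open>Evaluating the defining relation of a version at the images under \<open>g\<close>
  cancels the inverse, because almost every point lies in \<open>J\<^sub>1\<close>, on which
  \<open>g\<close> is injective.\<close>

lemma version_of_pullback:
  assumes "version_of G \<Gamma>" and eq: "AE p in unit_leb_pair. G p = G' p"
  obtains g where "g \<in> measurable unit_leb unit_leb" "distr unit_leb unit_leb g = unit_leb"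
    "AE p in unit_leb_pair. G' (g (fst p), g (snd p)) = \<Gamma> p"
proof -
  obtain g J\<^sub>1 J\<^sub>2 where bij: "almost_bijection g J\<^sub>1 J\<^sub>2" and mp: "measure_preserving g"
    and ver: "AE (x, y) in unit_square_leb. G (x, y) = \<Gamma> (inv_into J\<^sub>1 g x, inv_into J\<^sub>1 g y)"
    using assms(1) unfolding version_of_def by blast
  have g: "g \<in> measurable unit_leb unit_leb" "distr unit_leb unit_leb g = unit_leb"
    using mp by (auto simp: measure_preserving_def)
  have sf: "sigma_finite_measure unit_leb" ..
  have J: "AE x in unit_leb. x \<in> J\<^sub>1"
  proof (rule AE_I')
    show "{0..1} - J\<^sub>1 \<in> null_sets unit_leb"
      using bij by (simp add: almost_bijection_def conull_def)
  qed auto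
  have inv: "inv_into J\<^sub>1 g (g x) = x" if "x \<in> J\<^sub>1" for x
    using bij that by (intro inv_into_f_f) (auto simp: almost_bijection_def bij_betw_def)
  have "AE p in unit_leb_pair. G p = \<Gamma> (inv_into J\<^sub>1 g (fst p), inv_into J\<^sub>1 g (snd p))"
    using ver by (simp add: AE_unit_square_leb_iff case_prod_unfold)
  with eq have "AE p in unit_leb_pair. G' p = \<Gamma> (inv_into J\<^sub>1 g (fst p), inv_into J\<^sub>1 g (snd p))"
    by eventually_elim simp
  \<comment> \<open>The relation holds only almost everywhere; substituting \<open>g\<close> in both
    coordinates is legitimate because preimages of null sets are null.\<close>
  from AE_compose_measure_preserving[OF measure_preserving_pair[OF sf g] this]
  have "AE p in unit_leb_pair. G' (g (fst p), g (snd p)) = \<Gamma> p"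
    using AE_pair_measure_fst[OF sf J] AE_pair_measure_snd[OF sf J]
    by eventually_elim (simp add: inv)
  with g show thesis
    by (rule that)
qed

text \<open>The square has finite measure, so indicators are admissible test functions; the
  integrals against them then move to the representatives.\<close>

lemma weak_star_limit_indicator:
  assumes "weak_star_limit V U"
    and V: "\<And>n. V n \<in> borel_measurable unit_square_leb" "\<And>n. V' n \<in> borel_measurable unit_leb_pair"
      "\<And>n. AE p in unit_leb_pair. V n p = V' n p"
    and U: "U \<in> borel_measurable unit_square_leb" "U' \<in> borel_measurable unit_leb_pair"
      "AE p in unit_leb_pair. U p = U' p"
    and A: "A \<in> sets unit_leb_pair"
  shows "(\<lambda>n. LINT p|unit_leb_pair. indicator A p * V' n p) \<longlonglongrightarrow> (LINT p|unit_leb_pair. indicator A p * U' p)"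
proof -
  have ind: "indicator A \<in> borel_measurable unit_square_leb"
    using measurable_compose[OF measurable_unit_square_leb borel_measurable_indicator[OF A]] .
  interpret unit_square: finite_measure unit_square_leb
    by (rule finite_measure_lebesgue_on) (auto simp: lmeasurable_compact compact_Times)
  have "integrable unit_square_leb (indicator A :: _ \<Rightarrow> real)"
    using ind by (intro unit_square.integrable_const_bound[of _ 1]) (auto simp: indicator_def)
  then have lim: "(\<lambda>n. LINT p|unit_square_leb. indicator A p * V n p) \<longlonglongrightarrow> (LINT p|unit_square_leb. indicator A p * U p)"
    using assms(1) by (simp add: weak_star_limit_def)
  have *: "(LINT p|unit_square_leb. indicator A p * X p) = (LINT p|unit_leb_pair. indicator A p * X' p)"
    if "X \<in> borel_measurable unit_square_leb" "X' \<in> borel_measurable unit_leb_pair" "AE p in unit_leb_pair. X p = X' p"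
    for X X' :: "real \<times> real \<Rightarrow> real"
    using that ind A
    by (intro integral_unit_square_leb borel_measurable_times) (auto elim!: eventually_mono)
  from lim show ?thesis
    by (simp only: *[OF V] *[OF U])
qed

lemma strictly_concave_on_imp_concave_on:
  assumes "strictly_concave_on S f"
  shows "concave_on S f"
  unfolding concave_on_def
proof (rule convex_onI)
  fix t x y :: real assume t: "0 < t" "t < 1" and xy: "x \<in> S" "y \<in> S"
  show "- f ((1 - t) *\<^sub>R x + t *\<^sub>R y) \<le> (1 - t) * - f x + t * - f y"
  proof (cases "x = y")
    case True
    then show ?thesis
      by (simp add: algebra_simps)
  next
    case False
    then show ?thesis
      using assms t xy by (force simp: strictly_concave_on_def)
  qed
qed (use assms in \<open>simp add: strictly_concave_on_def\<close>)

theorem proposition4: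
  fixes f :: "real \<Rightarrow> real"
    and \<Gamma> :: "nat \<Rightarrow> real \<times> real \<Rightarrow> real"
    and W :: "real \<times> real \<Rightarrow> real"
  assumes "continuous_on {0..1} f"
    and "strictly_concave_on {0..1} f"
    and "\<And>n. graphon (\<Gamma> n)"
    and "W \<in> LIM_weak_star \<Gamma>"
    and "\<exists>\<Gamma>'. (\<forall>n. version_of (\<Gamma>' n) (\<Gamma> n)) \<and>
           (\<lambda>n. cut_norm (\<lambda>p. \<Gamma>' n p - W p)) \<longlonglongrightarrow> 0"
  shows "is_arg_min (INT_fun f) (\<lambda>U. U \<in> LIM_weak_star \<Gamma>) W"
proof -
  have "INT_fun f W \<le> INT_fun f U" if U: "U \<in> LIM_weak_star \<Gamma>" for U
  proof -
    have "unit_valued_kernel W" and kU: "unit_valued_kernel U"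
      using assms(4) U by (auto simp: LIM_weak_star_def)
    obtain W' where W': "W' \<in> borel_measurable unit_leb_pair" "\<And>p. W' p \<in> {0..1}" "AE p in unit_leb_pair. W p = W' p"
      using unit_valued_kernel_representative[OF \<open>unit_valued_kernel W\<close>] by blast
    obtain U' where U': "U' \<in> borel_measurable unit_leb_pair" "\<And>p. U' p \<in> {0..1}" "AE p in unit_leb_pair. U p = U' p"
      using unit_valued_kernel_representative[OF kU] by blast
    obtain V where V: "\<And>n. version_of (V n) (\<Gamma> n)" "weak_star_limit V U"
      using U unfolding LIM_weak_star_def by blast
    obtain C where C: "\<And>n. version_of (C n) (\<Gamma> n)" "(\<lambda>n. cut_norm (\<lambda>p. C n p - W p)) \<longlonglongrightarrow> 0"
      using assms(5) by blast
    have gr: "graphon (V n)" "graphon (C n)" for n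
      using V(1) C(1) by (auto simp: version_of_def)
    \<comment> \<open>Choice fixes, for all \<open>n\<close> at once, representatives of both
      versions and the measure preserving maps behind them.\<close>
    have "\<forall>n. \<exists>G. G \<in> borel_measurable unit_leb_pair \<and> (\<forall>p. G p \<in> {0..1}) \<and> (AE p in unit_leb_pair. V n p = G p)"
      by (intro allI, rule graphon_representative[OF gr(1)]) blast
    from choice[OF this] obtain G where
      "\<forall>n. G n \<in> borel_measurable unit_leb_pair \<and> (\<forall>p. G n p \<in> {0..1}) \<and> (AE p in unit_leb_pair. V n p = G n p)" ..
    then have G: "\<And>n. G n \<in> borel_measurable unit_leb_pair" "\<And>n p. G n p \<in> {0..1}"
      "\<And>n. AE p in unit_leb_pair. V n p = G n p"
      by blast+
    \<comment> \<open>Symmetry everywhere is retained for \<open>H n\<close>, as polarization is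
      applied to its difference from the symmetrized limit.\<close>
    have "\<forall>n. \<exists>H. H \<in> borel_measurable unit_leb_pair \<and> (\<forall>p. H p \<in> {0..1}) \<and> (\<forall>x y. H (x, y) = H (y, x))
        \<and> (AE p in unit_leb_pair. C n p = H p)"
      by (intro allI, rule graphon_representative[OF gr(2)]) blast
    from choice[OF this] obtain H where
      "\<forall>n. H n \<in> borel_measurable unit_leb_pair \<and> (\<forall>p. H n p \<in> {0..1}) \<and> (\<forall>x y. H n (x, y) = H n (y, x))
        \<and> (AE p in unit_leb_pair. C n p = H n p)" ..
    then have H: "\<And>n. H n \<in> borel_measurable unit_leb_pair" "\<And>n p. H n p \<in> {0..1}"
      "\<And>n x y. H n (x, y) = H n (y, x)" "\<And>n. AE p in unit_leb_pair. C n p = H n p"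
      by blast+
    have "\<forall>n. \<exists>g. g \<in> measurable unit_leb unit_leb \<and> distr unit_leb unit_leb g = unit_leb
        \<and> (AE p in unit_leb_pair. G n (g (fst p), g (snd p)) = \<Gamma> n p)"
      by (intro allI, rule version_of_pullback[OF V(1) G(3)]) blast
    from choice[OF this] obtain g where "\<forall>n. g n \<in> measurable unit_leb unit_leb \<and> distr unit_leb unit_leb (g n) = unit_leb
        \<and> (AE p in unit_leb_pair. G n (g n (fst p), g n (snd p)) = \<Gamma> n p)" ..
    then have g: "\<And>n. g n \<in> measurable unit_leb unit_leb" "\<And>n. distr unit_leb unit_leb (g n) = unit_leb"
      "\<And>n. AE p in unit_leb_pair. G n (g n (fst p), g n (snd p)) = \<Gamma> n p"
      by blast+
    have "\<forall>n. \<exists>d. d \<in> measurable unit_leb unit_leb \<and> distr unit_leb unit_leb d = unit_leb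
        \<and> (AE p in unit_leb_pair. H n (d (fst p), d (snd p)) = \<Gamma> n p)"
      by (intro allI, rule version_of_pullback[OF C(1) H(4)]) blast
    from choice[OF this] obtain d where "\<forall>n. d n \<in> measurable unit_leb unit_leb \<and> distr unit_leb unit_leb (d n) = unit_leb
        \<and> (AE p in unit_leb_pair. H n (d n (fst p), d n (snd p)) = \<Gamma> n p)" ..
    then have d: "\<And>n. d n \<in> measurable unit_leb unit_leb" "\<And>n. distr unit_leb unit_leb (d n) = unit_leb"
      "\<And>n. AE p in unit_leb_pair. H n (d n (fst p), d n (snd p)) = \<Gamma> n p"
      by blast+
    have "(LINT p|unit_leb_pair. f (W' p)) \<le> (LINT p|unit_leb_pair. f (U' p))"
    proof (rule unit_leb.integral_concave_le_of_cut_limit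
        [OF strictly_concave_on_imp_concave_on[OF assms(2)] assms(1) U'(1,2) W'(1,2) G(1,2) H(1,2,3) g(1,2) d(1,2)])
      \<comment> \<open>Both pullbacks equal \<open>\<Gamma> n\<close> almost everywhere, so the
        original kernel drops out of the comparison.\<close>
      show "AE p in unit_leb_pair. G n (g n (fst p), g n (snd p)) = H n (d n (fst p), d n (snd p))" for n
        using g(3)[of n] d(3)[of n] by eventually_elim simp
      show "(\<lambda>n. LINT p|unit_leb_pair. indicator A p * G n p) \<longlonglongrightarrow> (LINT p|unit_leb_pair. indicator A p * U' p)"
        if "A \<in> sets unit_leb_pair" for A
        using gr(1) kU that
        by (intro weak_star_limit_indicator[OF V(2) _ G(1,3) _ U'(1,3)]) (auto simp: graphon_def unit_valued_kernel_def)
      show "\<bar>LINT p|unit_leb_pair. indicator (A \<times> A) p * (H n p - W' p)\<bar> \<le> cut_norm (\<lambda>p. C n p - W p)"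
        if "A \<in> sets unit_leb" for n A
      proof (rule abs_integral_square_le_cut_norm[OF _ _ _ that])
        show "\<bar>H n p - W' p\<bar> \<le> 1" for p
          using H(2)[of n p] W'(2)[of p] by auto
        show "AE p in unit_leb_pair. C n p - W p = H n p - W' p"
          using H(4)[of n] W'(3) by eventually_elim simp
      qed (use H(1) W'(1) in measurable)
      show "(\<lambda>n. cut_norm (\<lambda>p. C n p - W p)) \<longlonglongrightarrow> 0"
        by (rule C(2))
    qed
    then show ?thesis
      using INT_fun_eq_integral[OF assms(1) W'] INT_fun_eq_integral[OF assms(1) U'] by simp
  qed
  then show ?thesis
    using assms(4) unfolding is_arg_min_def by force
qed

end
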